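(* Assume (H1), (H2), (H4) and let $J:H_0^1(\Omega)\to\mathbb{R}\cup\{+\infty\}$, $J(v)=\int_\Omega j(x,v,\nabla v)\,dx$. Then for every $(u,\eta)\in\operatorname{epi}(J)$ with $J(u)<\eta$ one has $|d\mathcal{G}_J|(u,\eta)=1$. Moreover, if $j(x,-s,-\xi)=j(x,s,\xi)$ for a.e. $x$ and all $(s,\xi)$, then $|d_{\mathbb{Z}_2}\mathcal{G}_J|(0,\eta)=1$ for every $\eta>J(0)=0$.
   Context: $\Omega\subset\mathbb{R}^N$ bounded open, $N\ge3$. $j:\Omega\times\mathbb{R}\times\mathbb{R}^N\to\mathbb{R}$ measurable in $x$, $C^1$ in $(s,\xi)$ for a.e. $x$, with partial derivatives $j_s,j_\xi$. (H1) $\xi\mapsto j(x,s,\xi)$ strictly convex. (H2) $\alpha_0|\xi|^2\le j(x,s,\xi)\le\alpha(|s|)|\xi|^2$ with $\alpha_0>0$ and $\alpha$ positive, increasing, continuous. (H4) there is $R>0$ with $j_s(x,s,\xi)s\ge0$ for $|s|\ge R$. $H_0^1(\Omega)$ carries the norm $\|\nabla u\|_{L^2}$. Weak slope: for a complete metric space $X$ and continuous $g:X\to\mathbb{R}$, $|dg|(u)$ is the supremum of $\sigma\ge0$ such that there exist $\delta>0$ and a continuous $\mathcal{H}:B(u,\delta)\times[0,\delta]\to X$ with $d(\mathcal{H}(v,t),v)\le t$ and $g(\mathcal{H}(v,t))\le g(v)-\sigma t$ for all $v\in B(u,\delta)$, $t\in[0,\delta]$. For lower semicontinuous $F:X\to\mathbb{R}\cup\{+\infty\}$,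 $\operatorname{epi}(F)=\{(u,\eta)\in X\times\mathbb{R}:F(u)\le\eta\}$ with metric $((d(u,v)^2+(\eta-\mu)^2)^{1/2}$, and $\mathcal{G}_F:\operatorname{epi}(F)\to\mathbb{R}$, $\mathcal{G}_F(u,\eta)=\eta$; $|d\mathcal{G}_F|$ is its weak slope. Equivariant weak slope: for a normed space $X$ and even lsc $F$ with $F(0)<\infty$, $|d_{\mathbb{Z}_2}\mathcal{G}_F|(0,\eta)$ is the supremum of $\sigma\ge0$ such that there exist $\delta>0$ and a continuous $\mathcal{H}=(\mathcal{H}_1,\mathcal{H}_2):(B((0,\eta),\delta)\cap\operatorname{epi}(F))\times[0,\delta]\to\operatorname{epi}(F)$ with $d(\mathcal{H}((w,\mu),t),(w,\mu))\le t$, $\mathcal{H}_2((w,\mu),t)\le\mu-\sigma t$ and $\mathcal{H}_1((-w,\mu),t)=-\mathcal{H}_1((w,\mu),t)$ for all $(w,\mu)\in B((0,\eta),\delta)\cap\operatorname{epi}(F)$, $t\in[0,\delta]$. *)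

theory Defs
  imports "HOL-Analysis.Analysis"
begin

definition mball :: "'a set \<Rightarrow> ('a \<Rightarrow> 'a \<Rightarrow> real) \<Rightarrow> 'a \<Rightarrow> real \<Rightarrow> 'a set" where
  "mball X d u r = {v \<in> X. d u v < r}"

definition dcont :: "('a \<Rightarrow> 'a \<Rightarrow> real) \<Rightarrow> ('a \<times> real) set \<Rightarrow> ('a \<times> real \<Rightarrow> 'a) \<Rightarrow> bool" where
  "dcont d S H \<longleftrightarrow>
     (\<forall>p\<in>S. \<forall>e>0. \<exists>r>0. \<forall>q\<in>S. d (fst q) (fst p) + \<bar>snd q - snd p\<bar> < r \<longrightarrow> d (H q) (H p) < e)"

definition wslope :: "'a set \<Rightarrow> ('a \<Rightarrow> 'a \<Rightarrow> real) \<Rightarrow> ('a \<Rightarrow> real) \<Rightarrow> 'a \<Rightarrow> ereal" where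
  "wslope X d g u = (SUP \<sigma> \<in> {\<sigma>::real. 0 \<le> \<sigma> \<and>
      (\<exists>\<delta>>0. \<exists>H. dcont d (mball X d u \<delta> \<times> {0..\<delta>}) H \<and>
         (\<forall>v\<in>mball X d u \<delta>. \<forall>t\<in>{0..\<delta>}.
            H (v, t) \<in> X \<and> d (H (v, t)) v \<le> t \<and> g (H (v, t)) \<le> g v - \<sigma> * t))}. ereal \<sigma>)"

definition epi :: "'a set \<Rightarrow> ('a \<Rightarrow> ereal) \<Rightarrow> ('a \<times> real) set" where
  "epi X F = {(u, \<eta>). u \<in> X \<and> F u \<le> ereal \<eta>}"

definition epi_dist :: "('a \<Rightarrow> 'a \<Rightarrow> real) \<Rightarrow> 'a \<times> real \<Rightarrow> 'a \<times> real \<Rightarrow> real" where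
  "epi_dist d p q = sqrt ((d (fst p) (fst q))\<^sup>2 + (snd p - snd q)\<^sup>2)"

definition epi_slope :: "'a set \<Rightarrow> ('a \<Rightarrow> 'a \<Rightarrow> real) \<Rightarrow> ('a \<Rightarrow> ereal) \<Rightarrow> 'a \<times> real \<Rightarrow> ereal" where
  "epi_slope X d F p = wslope (epi X F) (epi_dist d) snd p"

text \<open>Equivariant weak slope of G_F at (z, eta), z the origin, neg the negation.\<close>
definition epi_slope_Z2 ::
  "'a set \<Rightarrow> ('a \<Rightarrow> 'a \<Rightarrow> real) \<Rightarrow> ('a \<Rightarrow> ereal) \<Rightarrow> ('a \<Rightarrow> 'a) \<Rightarrow> 'a \<Rightarrow> real \<Rightarrow> ereal" where
  "epi_slope_Z2 X d F neg z \<eta> = (SUP \<sigma> \<in> {\<sigma>::real. 0 \<le> \<sigma> \<and>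
      (\<exists>\<delta>>0. \<exists>H. dcont (epi_dist d) (mball (epi X F) (epi_dist d) (z, \<eta>) \<delta> \<times> {0..\<delta>}) H \<and>
         (\<forall>w \<mu> t. (w, \<mu>) \<in> mball (epi X F) (epi_dist d) (z, \<eta>) \<delta> \<and> t \<in> {0..\<delta>} \<longrightarrow>
            H ((w, \<mu>), t) \<in> epi X F \<and>
            epi_dist d (H ((w, \<mu>), t)) (w, \<mu>) \<le> t \<and>
            snd (H ((w, \<mu>), t)) \<le> \<mu> - \<sigma> * t \<and>
            fst (H ((neg w, \<mu>), t)) = neg (fst (H ((w, \<mu>), t)))))}. ereal \<sigma>)"

definition Cc1 :: "('n::euclidean_space) set \<Rightarrow> ('n \<Rightarrow> real) \<Rightarrow> ('n \<Rightarrow> 'n) \<Rightarrow> bool" where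
  "Cc1 \<Omega> \<phi> D\<phi> \<longleftrightarrow> (\<forall>x. (\<phi> has_derivative (\<lambda>h. D\<phi> x \<bullet> h)) (at x)) \<and> continuous_on UNIV D\<phi> \<and>
     (\<exists>K. compact K \<and> K \<subseteq> \<Omega> \<and> (\<forall>x. x \<notin> K \<longrightarrow> \<phi> x = 0))"

text \<open>Elements of H_0^1 are represented by pairs (u, g), g the weak gradient of u:
  limits in the H^1 norm of C^1_c(Omega) functions (completion definition).\<close>
definition H01 :: "('n::euclidean_space) set \<Rightarrow> (('n \<Rightarrow> real) \<times> ('n \<Rightarrow> 'n)) set" where
  "H01 \<Omega> = {(u, g). u \<in> borel_measurable lebesgue \<and> g \<in> borel_measurable lebesgue \<and>
     (\<exists>\<phi> D\<phi>. (\<forall>k. Cc1 \<Omega> (\<phi> k) (D\<phi> k)) \<and>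
        (\<lambda>k. \<integral>\<^sup>+ x\<in>\<Omega>. ennreal ((\<phi> k x - u x)\<^sup>2) \<partial>lebesgue) \<longlonglongrightarrow> 0 \<and>
        (\<lambda>k. \<integral>\<^sup>+ x\<in>\<Omega>. ennreal ((norm (D\<phi> k x - g x))\<^sup>2) \<partial>lebesgue) \<longlonglongrightarrow> 0)}"

definition H01_dist :: "('n::euclidean_space) set \<Rightarrow> ('n \<Rightarrow> real) \<times> ('n \<Rightarrow> 'n) \<Rightarrow> ('n \<Rightarrow> real) \<times> ('n \<Rightarrow> 'n) \<Rightarrow> real" where
  "H01_dist \<Omega> p q = sqrt (enn2real (\<integral>\<^sup>+ x\<in>\<Omega>. ennreal ((norm (snd p x - snd q x))\<^sup>2) \<partial>lebesgue))"

definition H01_neg :: "('n \<Rightarrow> real) \<times> ('n \<Rightarrow> 'n::euclidean_space) \<Rightarrow> ('n \<Rightarrow> real) \<times> ('n \<Rightarrow> 'n)" where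
  "H01_neg p = ((\<lambda>x. - fst p x), (\<lambda>x. - snd p x))"

definition H01_zero :: "('n \<Rightarrow> real) \<times> ('n \<Rightarrow> 'n::euclidean_space)" where
  "H01_zero = ((\<lambda>x. 0), (\<lambda>x. 0))"

definition Jfun :: "('n::euclidean_space) set \<Rightarrow> ('n \<Rightarrow> real \<Rightarrow> 'n \<Rightarrow> real) \<Rightarrow> ('n \<Rightarrow> real) \<times> ('n \<Rightarrow> 'n) \<Rightarrow> ereal" where
  "Jfun \<Omega> j p = enn2ereal (\<integral>\<^sup>+ x\<in>\<Omega>. ennreal (j x (fst p x) (snd p x)) \<partial>lebesgue)"

definition strictly_convex :: "('a::real_vector \<Rightarrow> real) \<Rightarrow> bool" where
  "strictly_convex f \<longleftrightarrow> (\<forall>x y t. x \<noteq> y \<and> 0 < t \<and> t < 1 \<longrightarrow>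
      f ((1 - t) *\<^sub>R x + t *\<^sub>R y) < (1 - t) * f x + t * f y)"

end

theory Submission
  imports Defs
begin

text \<open>
  The slope is at most \<open>1\<close> because the second coordinate is \<open>1\<close>-Lipschitz. For \<open>\<sigma> < 1\<close> one moves
  \<open>(v, \<mu>)\<close> to \<open>((1 - \<tau>) v + \<tau> \<theta>(v), \<mu> - \<sigma> t)\<close> with \<open>\<tau>\<close> proportional to \<open>t\<close>, where \<open>\<theta>\<close> is an odd
  \<open>C\<^sup>1\<close> truncation at a height \<open>K \<ge> R\<close>. Where \<open>\<bar>v\<bar> > K\<close> this shrinks \<open>\<bar>v\<bar>\<close> within \<open>{\<bar>s\<bar> \<ge> R}\<close>, so the sign
  condition on \<open>j\<^sub>s\<close> and convexity in \<open>\<xi>\<close> give \<open>J \<le> (1 - \<tau>) J(v) + \<tau> I(v)\<close> with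
  \<open>I(v) = \<integral> \<theta>'(v) j(x, v, \<nabla>v)\<close>. Unlike \<open>J\<close>, the functional \<open>I \<le> J\<close> is continuous on \<open>H\<^sub>0\<^sup>1\<close>, because
  \<open>\<theta>'\<close> has compact support; hence \<open>I(v)\<close> stays below \<open>\<eta>\<close> for \<open>v\<close> near \<open>u\<close>. For large \<open>K\<close> the
  displacement \<open>v - \<theta>(v)\<close> is small near \<open>u\<close>, so almost all of the allowed distance \<open>t\<close> goes into lowering
  \<open>\<mu>\<close>. Taking \<open>\<theta>\<close> of class \<open>C\<^sup>1\<close> rather than piecewise linear makes the chain rule and the
  continuity of \<open>v \<mapsto> \<theta>(v)\<close> elementary, and \<open>\<theta>\<close> being odd makes the deformation equivariant.
\<close>

section \<open>Convergence in mean square\<close>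

text \<open>Dependent choice: since each \<open>P n\<close> holds for all large indices, the next
  index can be taken beyond the previous one. It serves to thin a null sequence of integrals until
  the n-th term lies below \<open>(1/2)^n\<close>.\<close>

lemma strict_mono_choice:
  fixes P :: "nat \<Rightarrow> nat \<Rightarrow> bool"
  assumes "\<And>n. eventually (P n) sequentially"
  obtains r where "strict_mono r" "\<And>n. P n (r n)"
proof -
  have ex: "\<exists>y>x. P n y" for n x
  proof -
    obtain N where "\<And>k. k \<ge> N \<Longrightarrow> P n k"
      using assms[of n] by (auto simp: eventually_sequentially)
    then show ?thesis by (intro exI[of _ "max N (Suc x)"]) auto
  qed
  have "\<exists>r. \<forall>n. P n (r n) \<and> r n < r (Suc n)"
    by (rule dependent_nat_choice) (use ex in blast)+
  then show ?thesis using that by (metis strict_monoI_Suc)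
qed

text \<open>Mean-square convergence yields pointwise convergence only along a subsequence; this
  principle carries the conclusion back to the full sequence. If \<open>X\<close> left a
  neighbourhood of \<open>L\<close> infinitely often, enumerating those indices would give a
  subsequence of which no further subsequence tends to \<open>L\<close>.\<close>

lemma tendsto_via_subsequences:
  fixes X :: "nat \<Rightarrow> 'a::topological_space"
  assumes "\<And>r::nat \<Rightarrow> nat. strict_mono r \<Longrightarrow> \<exists>q::nat \<Rightarrow> nat. strict_mono q \<and> (\<lambda>n. X (r (q n))) \<longlonglongrightarrow> L"
  shows "X \<longlonglongrightarrow> L"
proof (rule topological_tendstoI)
  fix S assume S: "open S" "L \<in> S"
  show "\<forall>\<^sub>F n in sequentially. X n \<in> S"
  proof (rule ccontr)
    assume "\<not> ?thesis"
    then have inf: "infinite {n. X n \<notin> S}"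
      by (simp add: cofinite_eq_sequentially[symmetric] eventually_cofinite)
    define r where "r = enumerate {n. X n \<notin> S}"
    have r: "strict_mono r" "X (r n) \<notin> S" for n
      using strict_mono_enumerate[OF inf] enumerate_in_set[OF inf] by (auto simp: r_def)
    obtain q where q: "strict_mono q" "(\<lambda>n. X (r (q n))) \<longlonglongrightarrow> L"
      using assms[OF r(1)] by blast
    show False
      using topological_tendstoD[OF q(2) S] r(2) by (auto simp: eventually_sequentially)
  qed
qed

lemma norm_sum_sq_le:
  fixes a b :: "'a::real_normed_vector"
  shows "(norm (a + b))\<^sup>2 \<le> 2 * (norm a)\<^sup>2 + 2 * (norm b)\<^sup>2"
proof -
  have "(norm (a + b))\<^sup>2 \<le> (norm a + norm b)\<^sup>2"
    by (intro power_mono norm_triangle_ineq) auto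
  also have "\<dots> \<le> 2 * (norm a)\<^sup>2 + 2 * (norm b)\<^sup>2"
    using sum_squares_bound[of "norm a" "norm b"] by (simp add: power2_sum)
  finally show ?thesis .
qed

lemma norm_sq_le_diff:
  fixes a b :: "'a::real_normed_vector"
  shows "(norm a)\<^sup>2 \<le> 2 * (norm b)\<^sup>2 + 2 * (norm (a - b))\<^sup>2"
  using norm_sum_sq_le[of b "a - b"] by simp

text \<open>Along a subsequence whose squared errors have integrals below \<open>2\<^sup>-\<^sup>n\<close>, the sum of the errors is integrable:
  it forces pointwise convergence and serves as the majorant.\<close>
lemma nn_integral_tendsto_of_L2:
  fixes u :: "nat \<Rightarrow> 'a \<Rightarrow> real" and g :: "nat \<Rightarrow> 'a \<Rightarrow> 'b::euclidean_space"
  assumes [measurable]: "\<And>n. u n \<in> borel_measurable M" "u' \<in> borel_measurable M"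
      "\<And>n. g n \<in> borel_measurable M" "g' \<in> borel_measurable M"
      "\<And>n. F n \<in> borel_measurable M" "F' \<in> borel_measurable M" "w \<in> borel_measurable M"
    and u: "(\<lambda>n. \<integral>\<^sup>+x. ennreal ((u n x - u' x)\<^sup>2) \<partial>M) \<longlonglongrightarrow> 0"
    and g: "(\<lambda>n. \<integral>\<^sup>+x. ennreal ((norm (g n x - g' x))\<^sup>2) \<partial>M) \<longlonglongrightarrow> 0"
    and g': "(\<integral>\<^sup>+x. ennreal ((norm (g' x))\<^sup>2) \<partial>M) < \<infinity>"
    and w: "(\<integral>\<^sup>+x. w x \<partial>M) < \<infinity>"
    and bound: "\<And>n x. x \<in> space M \<Longrightarrow> F n x \<le> ennreal (C * (norm (g n x))\<^sup>2) + w x"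
    and conv: "\<And>r x. strict_mono r \<Longrightarrow> x \<in> space M \<Longrightarrow> (\<lambda>n. u (r n) x) \<longlonglongrightarrow> u' x \<Longrightarrow>
        (\<lambda>n. g (r n) x) \<longlonglongrightarrow> g' x \<Longrightarrow> (\<lambda>n. F (r n) x) \<longlonglongrightarrow> F' x"
  shows "(\<lambda>n. \<integral>\<^sup>+x. F n x \<partial>M) \<longlonglongrightarrow> (\<integral>\<^sup>+x. F' x \<partial>M)"
proof (rule tendsto_via_subsequences)
  fix r :: "nat \<Rightarrow> nat" assume r: "strict_mono r"
  define h where "h n x = ennreal ((u n x - u' x)\<^sup>2) + ennreal ((norm (g n x - g' x))\<^sup>2)" for n x
  have [measurable]: "h n \<in> borel_measurable M" for n unfolding h_def by measurable
  have "(\<lambda>n. \<integral>\<^sup>+x. h n x \<partial>M) = (\<lambda>n. (\<integral>\<^sup>+x. ennreal ((u n x - u' x)\<^sup>2) \<partial>M) + (\<integral>\<^sup>+x. ennreal ((norm (g n x - g' x))\<^sup>2) \<partial>M))"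
    unfolding h_def by (intro ext nn_integral_add) measurable
  then have "(\<lambda>n. \<integral>\<^sup>+x. h n x \<partial>M) \<longlonglongrightarrow> 0" using tendsto_add[OF u g] by simp
  from LIMSEQ_subseq_LIMSEQ[OF this r]
  have "(\<lambda>n. \<integral>\<^sup>+x. h (r n) x \<partial>M) \<longlonglongrightarrow> 0" by (simp add: o_def)
  then have "eventually (\<lambda>k. (\<integral>\<^sup>+x. h (r k) x \<partial>M) < ennreal ((1/2)^n)) sequentially" for n
    by (rule order_tendstoD) auto
  then obtain q where q: "strict_mono q" "\<And>n. (\<integral>\<^sup>+x. h (r (q n)) x \<partial>M) < ennreal ((1/2)^n)"
    using strict_mono_choice[of "\<lambda>n k. (\<integral>\<^sup>+x. h (r k) x \<partial>M) < ennreal ((1/2)^n)"] by metis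
  define G where "G x = (\<Sum>n. h (r (q n)) x)" for x
  have [measurable]: "G \<in> borel_measurable M" unfolding G_def by measurable
  have "(\<integral>\<^sup>+x. G x \<partial>M) = (\<Sum>n. \<integral>\<^sup>+x. h (r (q n)) x \<partial>M)"
    unfolding G_def by (intro nn_integral_suminf) measurable
  also have "\<dots> \<le> (\<Sum>n. ennreal ((1/2)^n))"
    by (intro suminf_le) (use q(2) in \<open>auto intro: less_imp_le\<close>)
  also have "\<dots> = ennreal (\<Sum>n. (1/2)^n)"
    by (intro suminf_ennreal2) (auto intro: summable_geometric)
  finally have Gfin: "(\<integral>\<^sup>+x. G x \<partial>M) < \<infinity>" by (auto simp: top_unique less_top[symmetric])
  have hG: "h (r (q n)) x \<le> G x" for n x
    unfolding G_def using sum_le_suminf[of "\<lambda>n. h (r (q n)) x" "{n}"] by simp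
  have Gae: "AE x in M. G x \<noteq> \<infinity>"
    using Gfin by (intro nn_integral_PInf_AE) auto
  \<comment> \<open>The majorant comes from |g_n|^2 <= 2 |g'|^2 + 2 |g_n - g'|^2, where the last
    square is a summand of \<open>h\<close> and so at most \<open>G\<close>. The absolute value is
    taken because \<open>C\<close> carries no sign.\<close>
  define D where "D x = ennreal (2 * \<bar>C\<bar>) * ennreal ((norm (g' x))\<^sup>2) + (ennreal (2 * \<bar>C\<bar>) * G x + w x)" for x
  have dom: "F (r (q n)) x \<le> D x" if "x \<in> space M" for n x
  proof -
    let ?y = "g (r (q n)) x"
    have "F (r (q n)) x \<le> ennreal (C * (norm ?y)\<^sup>2) + w x" using bound that by blast
    also have "C * (norm ?y)\<^sup>2 \<le> \<bar>C\<bar> * (2 * (norm (g' x))\<^sup>2 + 2 * (norm (?y - g' x))\<^sup>2)"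
      by (rule order_trans[OF mult_right_mono[of C "\<bar>C\<bar>"]])
         (auto intro!: mult_left_mono norm_sq_le_diff)
    then have "ennreal (C * (norm ?y)\<^sup>2) \<le> ennreal (2*\<bar>C\<bar>) * ennreal ((norm (g' x))\<^sup>2) + ennreal (2*\<bar>C\<bar>) * ennreal ((norm (?y - g' x))\<^sup>2)"
      by (simp add: ennreal_mult[symmetric] ennreal_plus[symmetric] algebra_simps del: ennreal_plus)
    also have "ennreal ((norm (?y - g' x))\<^sup>2) \<le> G x"
      by (rule order_trans[OF _ hG[of n x]]) (simp add: h_def)
    finally show ?thesis unfolding D_def
      by (simp add: add.assoc[symmetric] add_right_mono add_left_mono mult_left_mono)
  qed
  have Dfin: "(\<integral>\<^sup>+x. D x \<partial>M) < \<infinity>"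
    unfolding D_def using g' w Gfin
    by (subst nn_integral_add nn_integral_cmult; measurable?)+ (auto simp: ennreal_mult_less_top)
  have ae: "AE x in M. (\<lambda>n. F (r (q n)) x) \<longlonglongrightarrow> F' x"
    using Gae AE_space
  proof eventually_elim
    case (elim x)
    have "(\<lambda>n. h (r (q n)) x) \<longlonglongrightarrow> 0"
    proof -
      obtain c where c: "\<And>n. h (r (q n)) x = ennreal (c n)" "\<And>n. c n \<ge> 0"
        using that[of "\<lambda>n. (u (r (q n)) x - u' x)\<^sup>2 + (norm (g (r (q n)) x - g' x))\<^sup>2"]
        by (auto simp: h_def)
      have "summable c"
        using elim(1) c unfolding G_def by (intro summable_suminf_not_top) auto
      then show ?thesis unfolding c(1) by (simp add: ennreal_tendsto_0_iff c(2) summable_LIMSEQ_zero)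
    qed
    then have h0: "(\<lambda>n. (u (r (q n)) x - u' x)\<^sup>2 + (norm (g (r (q n)) x - g' x))\<^sup>2) \<longlonglongrightarrow> 0"
      unfolding h_def by (simp add: ennreal_plus[symmetric] ennreal_tendsto_0_iff del: ennreal_plus)
    have "(\<lambda>n. (u (r (q n)) x - u' x)\<^sup>2) \<longlonglongrightarrow> 0"
      by (rule tendsto_sandwich[OF _ _ tendsto_const h0]) auto
    then have u0: "(\<lambda>n. u (r (q n)) x) \<longlonglongrightarrow> u' x"
      by (metis LIM_zero_cancel power_tendsto_0_iff pos2)
    have "(\<lambda>n. (norm (g (r (q n)) x - g' x))\<^sup>2) \<longlonglongrightarrow> 0"
      by (rule tendsto_sandwich[OF _ _ tendsto_const h0]) auto
    then have "(\<lambda>n. norm (g (r (q n)) x - g' x)) \<longlonglongrightarrow> 0"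
      by (simp add: power_tendsto_0_iff)
    then have g0: "(\<lambda>n. g (r (q n)) x) \<longlonglongrightarrow> g' x"
      by (rule LIM_zero_cancel[OF tendsto_norm_zero_cancel])
    show ?case
      \<comment> \<open>The hypothesis \<open>conv\<close> speaks of subsequences because
        \<open>F n\<close> may depend on n in other ways than through \<open>u n\<close> and
        \<open>g n\<close>; here the subsequence is \<open>r o q\<close>.\<close>
      using conv[OF strict_mono_o[OF r q(1)] elim(2)] u0 g0 by (simp add: o_def)
  qed
  have "(\<lambda>n. \<integral>\<^sup>+x. F (r (q n)) x \<partial>M) \<longlonglongrightarrow> (\<integral>\<^sup>+x. F' x \<partial>M)"
  proof (rule nn_integral_dominated_convergence[where w=D])
    show "D \<in> borel_measurable M" unfolding D_def by measurable
  qed (use dom Dfin ae in auto)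
  then show "\<exists>q. strict_mono q \<and> (\<lambda>n. \<integral>\<^sup>+x. F (r (q n)) x \<partial>M) \<longlonglongrightarrow> (\<integral>\<^sup>+x. F' x \<partial>M)"
    using q(1) by blast
qed

text \<open>Approximate \<open>p\<close> pointwise by simple functions \<open>s i\<close>. Then
  \<open>f x (s i x)\<close> is a finite sum of the measurable sections \<open>f x y\<close>, each
  cut to a level set of \<open>s i\<close>, and continuity in y passes to the limit.\<close>

lemma borel_measurable_caratheodory:
  fixes f :: "'a \<Rightarrow> 'b::{second_countable_topology,metric_space} \<Rightarrow> real"
  assumes p: "p \<in> borel_measurable M"
    and f: "\<And>y. (\<lambda>x. f x y) \<in> borel_measurable M"
    and cont: "\<And>x. x \<in> space M \<Longrightarrow> continuous_on UNIV (f x)"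
  shows "(\<lambda>x. f x (p x)) \<in> borel_measurable M"
proof -
  obtain s where s: "\<And>i. simple_function M (s i)" "\<And>x. x \<in> space M \<Longrightarrow> (\<lambda>i. s i x) \<longlonglongrightarrow> p x"
    using borel_measurable_implies_sequence_metric[OF p, of undefined] by blast
  show ?thesis
  proof (rule borel_measurable_LIMSEQ_real)
    fix i
    have fin: "finite (s i ` space M)" using s(1) by (rule simple_functionD)
    have "(\<lambda>x. \<Sum>y\<in>s i ` space M. indicator (s i -` {y} \<inter> space M) x * f x y) \<in> borel_measurable M"
      by (intro borel_measurable_sum borel_measurable_times f borel_measurable_indicator
          simple_functionD(2)[OF s(1)])
    also have "?this \<longleftrightarrow> (\<lambda>x. f x (s i x)) \<in> borel_measurable M"
    proof (rule measurable_cong)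
      fix x assume x: "x \<in> space M"
      have "(\<Sum>y\<in>s i ` space M. indicator (s i -` {y} \<inter> space M) x * f x y)
          = (\<Sum>y\<in>s i ` space M. if s i x = y then f x y else 0)"
        by (intro sum.cong) (auto simp: indicator_def x)
      also have "\<dots> = f x (s i x)" using fin x by simp
      finally show "(\<Sum>y\<in>s i ` space M. indicator (s i -` {y} \<inter> space M) x * f x y) = f x (s i x)" .
    qed
    finally show "(\<lambda>x. f x (s i x)) \<in> borel_measurable M" .
  next
    fix x assume "x \<in> space M"
    then show "(\<lambda>i. f x (s i x)) \<longlonglongrightarrow> f x (p x)"
      using continuous_on_tendsto_compose[OF cont s(2)] by simp
  qed
qed

section \<open>A smooth truncation\<close>

text \<open>A primitive of the positive part, hence C^1 across the kink. The difference of two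
  translates has a ramp from 0 to 1 as its derivative, which is how the slope of the truncation is
  brought down continuously.\<close>

definition half_sq_pos :: "real \<Rightarrow> real" where
  "half_sq_pos x = (max 0 x)\<^sup>2 / 2"

text \<open>Away from 0 the function agrees locally with y^2/2 or with 0; at 0 the difference
  quotient is squeezed by |h|.\<close>

lemma half_sq_pos_deriv: "(half_sq_pos has_real_derivative max 0 x) (at x)"
proof (cases "x = 0")
  case False
  show ?thesis
  proof (cases "x > 0")
    case True
    have "((\<lambda>y. y\<^sup>2 / 2) has_real_derivative max 0 x) (at x)"
      using True by (auto intro!: derivative_eq_intros)
    moreover have "eventually (\<lambda>y. y > 0) (nhds x)"
      using eventually_nhds_in_open[of "{0<..}" x] True by simp
    then have "eventually (\<lambda>y. y\<^sup>2 / 2 = half_sq_pos y) (nhds x)"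
      by eventually_elim (auto simp: half_sq_pos_def)
    ultimately show ?thesis using DERIV_cong_ev[OF refl, of "\<lambda>y. y\<^sup>2 / 2" half_sq_pos x "max 0 x" "max 0 x"] by simp
  next
    case F: False
    then have "((\<lambda>y. 0::real) has_real_derivative max 0 x) (at x)"
      by auto
    moreover have "x < 0" using F False by simp
    then have "eventually (\<lambda>y. y < 0) (nhds x)"
      using eventually_nhds_in_open[of "{..<0}" x] by simp
    then have "eventually (\<lambda>y. 0 = half_sq_pos y) (nhds x)"
      by eventually_elim (auto simp: half_sq_pos_def)
    ultimately show ?thesis using DERIV_cong_ev[OF refl, of "\<lambda>y. 0" half_sq_pos x "max 0 x" "max 0 x"] by simp
  qed
next
  case True
  have "(\<lambda>h. (half_sq_pos (0 + h) - half_sq_pos 0) / h) \<midarrow>0\<rightarrow> 0"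
  proof (rule Lim_null_comparison)
    show "\<forall>\<^sub>F h in at 0. norm ((half_sq_pos (0 + h) - half_sq_pos 0) / h) \<le> \<bar>h\<bar>"
      by (rule always_eventually) (auto simp: half_sq_pos_def max_def power2_eq_square divide_simps)
    show "((\<lambda>h::real. \<bar>h\<bar>) \<longlongrightarrow> 0) (at 0)" by (auto intro!: tendsto_eq_intros)
  qed
  then show ?thesis using True by (simp add: DERIV_def)
qed

text \<open>For \<open>K \<ge> 0\<close>, \<open>trunc K\<close> is the identity on \<open>[-K, K]\<close> and constant on each component of
  \<open>{\<bar>s\<bar> \<ge> K + 1}\<close>; \<open>dtrunc K\<close> is its derivative.\<close>

definition trunc :: "real \<Rightarrow> real \<Rightarrow> real" where
  "trunc K s = s - (half_sq_pos (s - K) - half_sq_pos (s - K - 1))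
                 + (half_sq_pos (- s - K) - half_sq_pos (- s - K - 1))"

definition dtrunc :: "real \<Rightarrow> real \<Rightarrow> real" where
  "dtrunc K s = 1 - (max 0 (s - K) - max 0 (s - K - 1)) - (max 0 (- s - K) - max 0 (- s - K - 1))"

lemma trunc_deriv: "(trunc K has_real_derivative dtrunc K s) (at s)"
  unfolding trunc_def dtrunc_def
  by (auto intro!: derivative_eq_intros DERIV_chain2[OF half_sq_pos_deriv])

lemma continuous_dtrunc: "continuous_on UNIV (dtrunc K)"
  unfolding dtrunc_def by (intro continuous_intros)

lemma dtrunc_bounds: "K \<ge> 0 \<Longrightarrow> 0 \<le> dtrunc K s" "dtrunc K s \<le> 1"
  by (auto simp: dtrunc_def max_def)

lemma dtrunc_inside: "\<bar>s\<bar> \<le> K \<Longrightarrow> dtrunc K s = 1"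
  by (auto simp: dtrunc_def max_def)

lemma dtrunc_outside: "K \<ge> 0 \<Longrightarrow> \<bar>s\<bar> \<ge> K + 1 \<Longrightarrow> dtrunc K s = 0"
  by (auto simp: dtrunc_def max_def abs_if split: if_splits)

lemma trunc_minus: "trunc K (- s) = - trunc K s" "dtrunc K (- s) = dtrunc K s"
  by (auto simp: trunc_def dtrunc_def)

lemma trunc_inside: "\<bar>s\<bar> \<le> K \<Longrightarrow> trunc K s = s"
  by (auto simp: trunc_def half_sq_pos_def max_def)

text \<open>With y = s - K, the truncation subtracts y^2/2 <= y while y <= 1 and is constant
  afterwards. The half-line s <= -K is reached later through oddness.\<close>

lemma trunc_bounds:
  assumes "K \<ge> 0" "s \<ge> K"
  shows "K \<le> trunc K s" "trunc K s \<le> s"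
proof -
  define y where "y = s - K"
  have y: "y \<ge> 0" "s = K + y" using assms by (auto simp: y_def)
  have e: "trunc K s = s - y\<^sup>2 / 2 + (max 0 (y - 1))\<^sup>2 / 2"
    using assms by (simp add: trunc_def half_sq_pos_def y_def)
  consider "y \<le> 1" | "y \<ge> 1" by linarith
  then have "K \<le> trunc K s \<and> trunc K s \<le> s"
  proof cases
    case 1
    have "y\<^sup>2 \<le> y" using 1 y(1) by (simp add: power2_eq_square mult_left_le)
    moreover have "y\<^sup>2 \<ge> 0" by simp
    ultimately show ?thesis using 1 y e by (auto simp: max_def)
  next
    case 2
    \<comment> \<open>The constant is the area under the falling slope: y - y^2/2 + (y - 1)^2/2 =
      1/2.\<close>
    have "trunc K s = K + 1/2"
      using 2 y e by (simp add: power2_eq_square algebra_simps add_divide_distrib diff_divide_distrib)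
    then show ?thesis using 2 y by auto
  qed
  then show "K \<le> trunc K s" "trunc K s \<le> s" by auto
qed

section \<open>The Poincare inequality\<close>

text \<open>The complement of a compact support is open and the function vanishes there, so its
  gradient vanishes there too: one compact set serves both.\<close>

lemma Cc1_support:
  assumes "Cc1 \<Omega> \<phi> D\<phi>"
  obtains K where "compact K" "K \<subseteq> \<Omega>" "\<And>x. x \<notin> K \<Longrightarrow> \<phi> x = 0" "\<And>x. x \<notin> K \<Longrightarrow> D\<phi> x = 0"
proof -
  obtain K where K: "compact K" "K \<subseteq> \<Omega>" "\<And>x. x \<notin> K \<Longrightarrow> \<phi> x = 0"
    and d: "\<And>x. (\<phi> has_derivative (\<lambda>h. D\<phi> x \<bullet> h)) (at x)"
    using assms by (auto simp: Cc1_def)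
  have "D\<phi> x = 0" if "x \<notin> K" for x
  proof -
    have "open (- K)" using K(1) compact_imp_closed by auto
    then have "((\<lambda>_. 0) has_derivative (\<lambda>h. D\<phi> x \<bullet> h)) (at x)"
      by (rule has_derivative_transform_within_open[OF d]) (use that K in auto)
    then have "(\<lambda>h. D\<phi> x \<bullet> h) = (\<lambda>_. 0)"
      by (rule has_derivative_unique) auto
    then have "D\<phi> x \<bullet> D\<phi> x = 0" by metis
    then show ?thesis by simp
  qed
  with K show ?thesis using that by blast
qed

lemma Cc1_continuous:
  assumes "Cc1 \<Omega> \<phi> D\<phi>"
  shows "continuous_on UNIV \<phi>" "continuous_on UNIV D\<phi>"
  using assms by (auto simp: Cc1_def intro!: has_derivative_continuous_on)

lemma Cc1_measurable:
  assumes "Cc1 \<Omega> \<phi> D\<phi>"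
  shows "\<phi> \<in> borel_measurable borel" "D\<phi> \<in> borel_measurable borel"
  using Cc1_continuous[OF assms] by (auto intro: borel_measurable_continuous_onI)

lemma integrable_continuous_compact_support:
  fixes f :: "'a::euclidean_space \<Rightarrow> real"
  assumes "continuous_on UNIV f" "compact K" "\<And>x. x \<notin> K \<Longrightarrow> f x = 0"
  shows "integrable lborel f"
proof -
  have "integrable lborel (\<lambda>x. indicator K x *\<^sub>R f x)"
    using assms by (intro borel_integrable_compact) (auto intro: continuous_on_subset)
  also have "(\<lambda>x. indicator K x *\<^sub>R f x) = f"
    using assms(3) by (auto simp: indicator_def fun_eq_iff)
  finally show ?thesis .
qed

text \<open>The gradient is continuous with compact support, hence bounded; the resulting constant
  dominates all difference quotients at once.\<close>

lemma Cc1_lipschitz: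
  assumes "Cc1 \<Omega> f Df"
  obtains L where "L \<ge> 0" "\<And>x y. \<bar>f x - f y\<bar> \<le> L * norm (x - y)"
proof -
  obtain K where K: "compact K" "\<And>x. x \<notin> K \<Longrightarrow> Df x = 0"
    using Cc1_support[OF assms] by metis
  have "bounded (Df ` K)"
    using Cc1_continuous[OF assms] K(1)
    by (intro compact_imp_bounded compact_continuous_image) (auto intro: continuous_on_subset)
  then obtain L where L: "L > 0" "\<And>x. x \<in> K \<Longrightarrow> norm (Df x) \<le> L"
    by (auto simp: bounded_pos)
  have L': "norm (Df x) \<le> L" for x using L K(2)[of x] by (cases "x \<in> K") auto
  have "norm (f x - f y) \<le> L * norm (x - y)" for x y
  proof (rule differentiable_bound[of UNIV f "\<lambda>x h. Df x \<bullet> h"])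
    fix x
    show "(f has_derivative (\<lambda>h. Df x \<bullet> h)) (at x within UNIV)" using assms by (simp add: Cc1_def)
    show "onorm (\<lambda>h. Df x \<bullet> h) \<le> L"
    proof (rule onorm_bound)
      fix h
      have "norm (Df x \<bullet> h) \<le> norm (Df x) * norm h" by (simp add: Cauchy_Schwarz_ineq2)
      also have "\<dots> \<le> L * norm h" using L' by (intro mult_right_mono) auto
      finally show "norm (Df x \<bullet> h) \<le> L * norm h" .
    qed (use L in auto)
  qed auto
  then show ?thesis using that[of L] L(1) by auto
qed

text \<open>The difference quotients in direction \<open>e\<close> integrate to \<open>0\<close> by translation invariance.\<close>
lemma integral_directional_derivative:
  fixes f :: "'a::euclidean_space \<Rightarrow> real"
  assumes f: "Cc1 \<Omega> f Df"
  shows "integrable lborel (\<lambda>x. Df x \<bullet> e)" "(\<integral>x. Df x \<bullet> e \<partial>lborel) = 0"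
proof -
  obtain K where K: "compact K" "\<And>x. x \<notin> K \<Longrightarrow> f x = 0" "\<And>x. x \<notin> K \<Longrightarrow> Df x = 0"
    using Cc1_support[OF f] by metis
  obtain B where B: "\<And>x. x \<in> K \<Longrightarrow> norm x \<le> B"
    using compact_imp_bounded[OF K(1)] by (auto simp: bounded_iff)
  obtain L where L: "L \<ge> 0" "\<And>x y. \<bar>f x - f y\<bar> \<le> L * norm (x - y)"
    using Cc1_lipschitz[OF f] by metis
  note cont = Cc1_continuous[OF f]
  have [measurable]: "f \<in> borel_measurable borel" "Df \<in> borel_measurable borel"
    using Cc1_measurable[OF f] by auto
  have int: "integrable lborel f"
    by (rule integrable_continuous_compact_support[OF cont(1) K(1,2)])
  have trans: "integrable lborel (\<lambda>x. f (c + x))" "(\<integral>x. f (c + x) \<partial>lborel) = (\<integral>x. f x \<partial>lborel)" for c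
    using int integrable_distr_eq[of "(+) c" lborel borel f] integral_distr[of "(+) c" lborel borel f]
    by (auto simp: lborel_distr_plus)
  show "integrable lborel (\<lambda>x. Df x \<bullet> e)"
    by (rule integrable_continuous_compact_support[OF _ K(1)]) (auto intro!: continuous_intros cont simp: K)
  define t where "t n = inverse (real (Suc n))" for n
  have t: "0 < t n" "t n \<le> 1" for n by (auto simp: t_def field_simps)
  have t0: "t \<longlonglongrightarrow> 0" unfolding t_def by (rule LIMSEQ_inverse_real_of_nat)
  define q where "q n x = (f (t n *\<^sub>R e + x) - f x) / t n" for n x
  have "(\<lambda>n. \<integral>x. q n x \<partial>lborel) \<longlonglongrightarrow> (\<integral>x. Df x \<bullet> e \<partial>lborel)"
  proof (rule integral_dominated_convergence)
    \<comment> \<open>The difference quotients are at most \<open>L * norm e\<close>. Since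
      \<open>t n\<close> is at most 1, all translates of the support stay in the ball of radius
      \<open>B + norm e\<close>, outside which the quotients vanish.\<close>
    show "integrable lborel (\<lambda>x. indicator (cball 0 (B + norm e)) x *\<^sub>R (L * norm e))"
      by (rule borel_integrable_compact) auto
    show "AE x in lborel. (\<lambda>n. q n x) \<longlonglongrightarrow> Df x \<bullet> e"
    proof (rule AE_I2)
      fix x
      have "((\<lambda>s. f (s *\<^sub>R e + x)) has_derivative (\<lambda>h. Df x \<bullet> (h *\<^sub>R e))) (at 0)"
      proof (rule has_derivative_compose[of "\<lambda>s. s *\<^sub>R e + x" "\<lambda>h. h *\<^sub>R e" 0 UNIV f, simplified])
        show "((\<lambda>s. s *\<^sub>R e + x) has_derivative (\<lambda>h. h *\<^sub>R e)) (at 0)"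
          by (auto intro!: derivative_eq_intros)
        show "(f has_derivative (\<bullet>) (Df x)) (at x)" using f by (simp add: Cc1_def)
      qed
      then have "((\<lambda>s. f (s *\<^sub>R e + x)) has_real_derivative (Df x \<bullet> e)) (at 0)"
        by (simp add: has_field_derivative_def mult.commute[of _ "Df x \<bullet> e"])
      then have lim: "((\<lambda>s. (f (s *\<^sub>R e + x) - f x) / s) \<longlongrightarrow> Df x \<bullet> e) (at 0)"
        by (simp add: DERIV_def)
      have "filterlim t (at 0) sequentially"
        using t0 t by (auto simp: filterlim_at intro!: always_eventually dest: less_imp_neq)
          (metis less_irrefl)
      from filterlim_compose[OF lim this] show "(\<lambda>n. q n x) \<longlonglongrightarrow> Df x \<bullet> e"
        by (simp add: q_def)
    qed
    show "AE x in lborel. norm (q n x) \<le> indicator (cball 0 (B + norm e)) x *\<^sub>R (L * norm e)" for n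
    proof (rule AE_I2)
      fix x
      have te: "norm (t n *\<^sub>R e) \<le> norm e" using t[of n] by (simp add: mult_left_le_one_le)
      show "norm (q n x) \<le> indicator (cball 0 (B + norm e)) x *\<^sub>R (L * norm e)"
      proof (cases "norm x \<le> B + norm e")
        case True
        have "\<bar>f (t n *\<^sub>R e + x) - f x\<bar> \<le> L * (t n * norm e)"
          using L(2)[of "t n *\<^sub>R e + x" x] t(1)[of n] by simp
        then have "norm (q n x) \<le> L * norm e"
          using t(1)[of n] by (simp add: q_def field_simps)
        then show ?thesis using True by simp
      next
        case False
        have "norm x \<le> norm (t n *\<^sub>R e + x) + norm (t n *\<^sub>R e)"
          using norm_triangle_ineq4[of "t n *\<^sub>R e + x" "t n *\<^sub>R e"] by simp
        then have "norm (t n *\<^sub>R e + x) > B" using False te by linarith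
        moreover have "norm x > B" using False by (smt (verit) norm_ge_zero)
        ultimately have "f (t n *\<^sub>R e + x) = 0" "f x = 0" using B K(2) by (metis not_le)+
        then show ?thesis using False by (simp add: q_def)
      qed
    qed
  qed (auto simp: q_def)
  moreover have "(\<integral>x. q n x \<partial>lborel) = 0" for n
    unfolding q_def using trans int by simp
  ultimately show "(\<integral>x. Df x \<bullet> e \<partial>lborel) = 0" by (simp add: LIMSEQ_const_iff)
qed

text \<open>Bridge between the two settings: calculus with test functions takes place under
  \<open>lborel\<close> on the whole space, while the norms live on
  \<open>lebesgue_on \<Omega>\<close>.\<close>

lemma nn_integral_lebesgue_on_supported:
  assumes "\<Omega> \<in> sets lebesgue" "\<And>x. x \<notin> \<Omega> \<Longrightarrow> f x = 0"
  shows "(\<integral>\<^sup>+x. f x \<partial>lebesgue_on \<Omega>) = (\<integral>\<^sup>+x. f x \<partial>lborel)"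
proof -
  have "(\<integral>\<^sup>+x. f x \<partial>lebesgue_on \<Omega>) = (\<integral>\<^sup>+x. f x * indicator \<Omega> x \<partial>lebesgue)"
    using assms(1) by (simp add: nn_integral_restrict_space)
  also have "\<dots> = (\<integral>\<^sup>+x. f x \<partial>lebesgue)"
    by (intro nn_integral_cong) (use assms(2) in \<open>auto simp: indicator_def\<close>)
  finally show ?thesis by (simp add: nn_integral_completion)
qed

lemma Cc1_L2_finite:
  fixes \<phi> :: "'a::euclidean_space \<Rightarrow> real"
  assumes \<phi>: "Cc1 \<Omega> \<phi> D\<phi>"
  shows "integrable lborel (\<lambda>x. (\<phi> x)\<^sup>2)" "integrable lborel (\<lambda>x. (norm (D\<phi> x))\<^sup>2)"
proof -
  obtain K where K: "compact K" "\<And>x. x \<notin> K \<Longrightarrow> \<phi> x = 0" "\<And>x. x \<notin> K \<Longrightarrow> D\<phi> x = 0"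
    using Cc1_support[OF \<phi>] by metis
  show "integrable lborel (\<lambda>x. (\<phi> x)\<^sup>2)" "integrable lborel (\<lambda>x. (norm (D\<phi> x))\<^sup>2)"
    by (rule integrable_continuous_compact_support[OF _ K(1)];
        auto intro!: continuous_intros Cc1_continuous[OF \<phi>] simp: K)+
qed

text \<open>Integrate \<open>\<partial>\<^sub>e ((x \<bullet> e) \<phi>\<^sup>2) = \<phi>\<^sup>2 + 2 (x \<bullet> e) \<phi> \<partial>\<^sub>e \<phi>\<close> and absorb
  half of \<open>\<phi>\<^sup>2\<close> by Young's inequality.\<close>
lemma Cc1_poincare:
  fixes \<phi> :: "'a::euclidean_space \<Rightarrow> real"
  assumes \<Omega>: "\<Omega> \<in> sets lebesgue" "\<Omega> \<subseteq> cball 0 B" and \<phi>: "Cc1 \<Omega> \<phi> D\<phi>"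
  shows "(\<integral>\<^sup>+x. ennreal ((\<phi> x)\<^sup>2) \<partial>lebesgue_on \<Omega>)
    \<le> ennreal (4 * B\<^sup>2) * (\<integral>\<^sup>+x. ennreal ((norm (D\<phi> x))\<^sup>2) \<partial>lebesgue_on \<Omega>)"
proof -
  obtain K where K: "compact K" "K \<subseteq> \<Omega>" "\<And>x. x \<notin> K \<Longrightarrow> \<phi> x = 0" "\<And>x. x \<notin> K \<Longrightarrow> D\<phi> x = 0"
    using Cc1_support[OF \<phi>] by metis
  obtain e :: 'a where e: "e \<in> Basis" using nonempty_Basis by blast
  then have ne: "norm e = 1" "e \<bullet> e = 1" by (auto simp: inner_Basis)
  define f where "f x = (x \<bullet> e) * (\<phi> x)\<^sup>2" for x
  define Df where "Df x = (\<phi> x)\<^sup>2 *\<^sub>R e + (2 * (x \<bullet> e) * \<phi> x) *\<^sub>R D\<phi> x" for x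
  have d\<phi>: "(\<phi> has_derivative (\<lambda>h. D\<phi> x \<bullet> h)) (at x)" for x using \<phi> by (simp add: Cc1_def)
  have "Cc1 \<Omega> f Df"
    unfolding Cc1_def
  proof (intro conjI allI exI[of _ K])
    fix x
    show "(f has_derivative (\<lambda>h. Df x \<bullet> h)) (at x)"
      unfolding f_def Df_def
      by (rule derivative_eq_intros d\<phi> refl | simp)+
         (auto simp: fun_eq_iff algebra_simps inner_add_left inner_commute)
    show "continuous_on UNIV Df" unfolding Df_def
      by (intro continuous_intros Cc1_continuous[OF \<phi>])
  qed (use K in \<open>auto simp: f_def\<close>)
  from integral_directional_derivative[OF this, of e]
  have i: "integrable lborel (\<lambda>x. Df x \<bullet> e)" "(\<integral>x. Df x \<bullet> e \<partial>lborel) = 0" .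
  note L2 = Cc1_L2_finite[OF \<phi>]
  have pt: "(\<phi> x)\<^sup>2 \<le> 2 * (Df x \<bullet> e) + 4 * B\<^sup>2 * (norm (D\<phi> x))\<^sup>2" for x
  proof (cases "x \<in> K")
    case True
    then have xB: "norm x \<le> B" using K \<Omega> by auto
    let ?a = "(x \<bullet> e) * (D\<phi> x \<bullet> e)"
    have "\<bar>?a\<bar> \<le> B * norm (D\<phi> x)"
      unfolding abs_mult
      by (intro mult_mono) (use Cauchy_Schwarz_ineq2[of x e] Cauchy_Schwarz_ineq2[of "D\<phi> x" e] xB ne
          in \<open>auto intro: order_trans\<close>)
    then have "?a\<^sup>2 \<le> (B * norm (D\<phi> x))\<^sup>2" by (rule abs_le_square_iff[THEN iffD1, OF order_trans]) simp
    then have a: "?a\<^sup>2 \<le> B\<^sup>2 * (norm (D\<phi> x))\<^sup>2" by (simp add: power_mult_distrib)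
    have "Df x \<bullet> e = (\<phi> x)\<^sup>2 + 2 * \<phi> x * ?a"
      by (simp add: Df_def inner_add_left ne algebra_simps)
    \<comment> \<open>With a for \<open>?a\<close>, (\<phi> + 2a)^2 = 2 (\<phi>^2 + 2 \<phi> a) -
      \<phi>^2 + 4 a^2, and the first bracket is \<open>Df x \<bullet> e\<close>. Together with a^2
      <= B^2 |D\<phi>|^2 this produces the factor 4 B^2.\<close>
    moreover have "0 \<le> (\<phi> x + 2 * ?a)\<^sup>2" by simp
    then have "0 \<le> (\<phi> x)\<^sup>2 + 4 * \<phi> x * ?a + 4 * ?a\<^sup>2"
      by (simp add: power2_sum power_mult_distrib algebra_simps)
    ultimately show ?thesis using a by linarith
  next
    case False
    then show ?thesis using K by (simp add: Df_def)
  qed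
  have "(\<integral>x. (\<phi> x)\<^sup>2 \<partial>lborel) \<le> (\<integral>x. 2 * (Df x \<bullet> e) + 4 * B\<^sup>2 * (norm (D\<phi> x))\<^sup>2 \<partial>lborel)"
    using L2 i pt by (intro integral_mono) auto
  also have "\<dots> = 4 * B\<^sup>2 * (\<integral>x. (norm (D\<phi> x))\<^sup>2 \<partial>lborel)"
    using L2 i by simp
  finally have "ennreal (\<integral>x. (\<phi> x)\<^sup>2 \<partial>lborel) \<le> ennreal (4 * B\<^sup>2) * ennreal (\<integral>x. (norm (D\<phi> x))\<^sup>2 \<partial>lborel)"
    by (simp add: ennreal_mult[symmetric] ennreal_leI)
  then have "(\<integral>\<^sup>+x. ennreal ((\<phi> x)\<^sup>2) \<partial>lborel) \<le> ennreal (4 * B\<^sup>2) * (\<integral>\<^sup>+x. ennreal ((norm (D\<phi> x))\<^sup>2) \<partial>lborel)"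
    using L2 by (simp add: nn_integral_eq_integral)
  moreover have "(\<integral>\<^sup>+x. ennreal ((\<phi> x)\<^sup>2) \<partial>lebesgue_on \<Omega>) = (\<integral>\<^sup>+x. ennreal ((\<phi> x)\<^sup>2) \<partial>lborel)"
    "(\<integral>\<^sup>+x. ennreal ((norm (D\<phi> x))\<^sup>2) \<partial>lebesgue_on \<Omega>) = (\<integral>\<^sup>+x. ennreal ((norm (D\<phi> x))\<^sup>2) \<partial>lborel)"
    by (rule nn_integral_lebesgue_on_supported[OF \<Omega>(1)]; use K in auto)+
  ultimately show ?thesis by simp
qed

section \<open>The space \<open>H\<^sub>0\<^sup>1\<close>\<close>

lemma set_nn_integral_lebesgue_on:
  "\<Omega> \<in> sets lebesgue \<Longrightarrow> (\<integral>\<^sup>+x\<in>\<Omega>. f x \<partial>lebesgue) = (\<integral>\<^sup>+x. f x \<partial>lebesgue_on \<Omega>)"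
  by (simp add: nn_integral_restrict_space)

text \<open>The general convergence theorem with the scalar component frozen at 0 and
  \<open>C = 1\<close>.\<close>

lemma L2_norm_tendsto:
  fixes g :: "nat \<Rightarrow> 'a \<Rightarrow> 'b::euclidean_space"
  assumes [measurable]: "\<And>n. g n \<in> borel_measurable M" "g' \<in> borel_measurable M"
    and g: "(\<lambda>n. \<integral>\<^sup>+x. ennreal ((norm (g n x - g' x))\<^sup>2) \<partial>M) \<longlonglongrightarrow> 0"
    and g': "(\<integral>\<^sup>+x. ennreal ((norm (g' x))\<^sup>2) \<partial>M) < \<infinity>"
  shows "(\<lambda>n. \<integral>\<^sup>+x. ennreal ((norm (g n x))\<^sup>2) \<partial>M) \<longlonglongrightarrow> (\<integral>\<^sup>+x. ennreal ((norm (g' x))\<^sup>2) \<partial>M)"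
  by (rule nn_integral_tendsto_of_L2[where u="\<lambda>_ _. 0" and u'="\<lambda>_. 0" and g=g and g'=g' and C=1 and w="\<lambda>_. 0"])
     (use g g' in \<open>auto intro!: tendsto_intros\<close>)

text \<open>Square integrability is inherited from a single approximant whose squared error has
  integral below 1. In this way elements of \<open>H01\<close> acquire it from the test
  functions.\<close>

lemma L2_finite_of_tendsto:
  fixes g :: "nat \<Rightarrow> 'a \<Rightarrow> 'b::euclidean_space"
  assumes [measurable]: "\<And>n. g n \<in> borel_measurable M" "g' \<in> borel_measurable M"
    and g: "(\<lambda>n. \<integral>\<^sup>+x. ennreal ((norm (g n x - g' x))\<^sup>2) \<partial>M) \<longlonglongrightarrow> 0"
    and fin: "\<And>n. (\<integral>\<^sup>+x. ennreal ((norm (g n x))\<^sup>2) \<partial>M) < \<infinity>"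
  shows "(\<integral>\<^sup>+x. ennreal ((norm (g' x))\<^sup>2) \<partial>M) < \<infinity>"
proof -
  obtain n where n: "(\<integral>\<^sup>+x. ennreal ((norm (g n x - g' x))\<^sup>2) \<partial>M) < 1"
    using order_tendstoD(2)[OF g, of 1] by (auto simp: eventually_sequentially)
  have "(\<integral>\<^sup>+x. ennreal ((norm (g' x))\<^sup>2) \<partial>M)
     \<le> (\<integral>\<^sup>+x. 2 * ennreal ((norm (g n x))\<^sup>2) + 2 * ennreal ((norm (g n x - g' x))\<^sup>2) \<partial>M)"
  proof (rule nn_integral_mono)
    fix x
    have "(norm (g' x))\<^sup>2 \<le> 2 * (norm (g n x))\<^sup>2 + 2 * (norm (g n x - g' x))\<^sup>2"
      using norm_sq_le_diff[of "g' x" "g n x"] by (simp add: norm_minus_commute)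
    from ennreal_leI[OF this]
    show "ennreal ((norm (g' x))\<^sup>2) \<le> 2 * ennreal ((norm (g n x))\<^sup>2) + 2 * ennreal ((norm (g n x - g' x))\<^sup>2)"
      by (simp add: ennreal_mult)
  qed
  also have "\<dots> = 2 * (\<integral>\<^sup>+x. ennreal ((norm (g n x))\<^sup>2) \<partial>M) + 2 * (\<integral>\<^sup>+x. ennreal ((norm (g n x - g' x))\<^sup>2) \<partial>M)"
    by (simp add: nn_integral_add nn_integral_cmult)
  also have "\<dots> < \<infinity>"
    using n fin[of n] by (auto simp: ennreal_mult_less_top intro: less_trans)
  finally show ?thesis .
qed

lemma L2_diff_tendsto:
  fixes g :: "nat \<Rightarrow> 'a \<Rightarrow> 'b::euclidean_space"
  assumes [measurable]: "\<And>n. g n \<in> borel_measurable M" "g' \<in> borel_measurable M"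
     "\<And>n. h n \<in> borel_measurable M" "h' \<in> borel_measurable M"
    and g: "(\<lambda>n. \<integral>\<^sup>+x. ennreal ((norm (g n x - g' x))\<^sup>2) \<partial>M) \<longlonglongrightarrow> 0"
    and h: "(\<lambda>n. \<integral>\<^sup>+x. ennreal ((norm (h n x - h' x))\<^sup>2) \<partial>M) \<longlonglongrightarrow> 0"
  shows "(\<lambda>n. \<integral>\<^sup>+x. ennreal ((norm ((g n x - h n x) - (g' x - h' x)))\<^sup>2) \<partial>M) \<longlonglongrightarrow> 0"
proof (rule tendsto_sandwich[OF _ _ tendsto_const])
  show "\<forall>\<^sub>F n in sequentially. (\<integral>\<^sup>+x. ennreal ((norm ((g n x - h n x) - (g' x - h' x)))\<^sup>2) \<partial>M)
     \<le> 2 * (\<integral>\<^sup>+x. ennreal ((norm (g n x - g' x))\<^sup>2) \<partial>M) + 2 * (\<integral>\<^sup>+x. ennreal ((norm (h n x - h' x))\<^sup>2) \<partial>M)"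
  proof (rule always_eventually, rule allI)
    fix n
    have "(\<integral>\<^sup>+x. ennreal ((norm ((g n x - h n x) - (g' x - h' x)))\<^sup>2) \<partial>M)
     \<le> (\<integral>\<^sup>+x. 2 * ennreal ((norm (g n x - g' x))\<^sup>2) + 2 * ennreal ((norm (h n x - h' x))\<^sup>2) \<partial>M)"
    proof (rule nn_integral_mono)
      fix x
      have "(norm ((g n x - h n x) - (g' x - h' x)))\<^sup>2 \<le> 2 * (norm (g n x - g' x))\<^sup>2 + 2 * (norm (h n x - h' x))\<^sup>2"
        using norm_sum_sq_le[of "g n x - g' x" "h' x - h n x"]
        by (simp add: norm_minus_commute algebra_simps)
      from ennreal_leI[OF this]
      show "ennreal ((norm ((g n x - h n x) - (g' x - h' x)))\<^sup>2)
          \<le> 2 * ennreal ((norm (g n x - g' x))\<^sup>2) + 2 * ennreal ((norm (h n x - h' x))\<^sup>2)"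
        by (simp add: ennreal_mult)
    qed
    also have "\<dots> = 2 * (\<integral>\<^sup>+x. ennreal ((norm (g n x - g' x))\<^sup>2) \<partial>M) + 2 * (\<integral>\<^sup>+x. ennreal ((norm (h n x - h' x))\<^sup>2) \<partial>M)"
      by (simp add: nn_integral_add nn_integral_cmult)
    finally show "(\<integral>\<^sup>+x. ennreal ((norm ((g n x - h n x) - (g' x - h' x)))\<^sup>2) \<partial>M) \<le> \<dots>" .
  qed
  have "(\<lambda>n. 2 * (\<integral>\<^sup>+x. ennreal ((norm (g n x - g' x))\<^sup>2) \<partial>M) + 2 * (\<integral>\<^sup>+x. ennreal ((norm (h n x - h' x))\<^sup>2) \<partial>M)) \<longlonglongrightarrow> 2 * 0 + 2 * 0"
    by (intro tendsto_add ennreal_tendsto_cmult g h) auto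
  then show "(\<lambda>n. 2 * (\<integral>\<^sup>+x. ennreal ((norm (g n x - g' x))\<^sup>2) \<partial>M) + 2 * (\<integral>\<^sup>+x. ennreal ((norm (h n x - h' x))\<^sup>2) \<partial>M)) \<longlonglongrightarrow> 0"
    by simp
qed auto

lemma Cc1_diff:
  assumes "Cc1 \<Omega> \<phi> D\<phi>" "Cc1 \<Omega> \<psi> D\<psi>"
  shows "Cc1 \<Omega> (\<lambda>x. \<phi> x - \<psi> x) (\<lambda>x. D\<phi> x - D\<psi> x)"
proof -
  obtain K where K: "compact K" "K \<subseteq> \<Omega>" "\<And>x. x \<notin> K \<Longrightarrow> \<phi> x = 0"
    using assms(1) by (auto simp: Cc1_def)
  obtain L where L: "compact L" "L \<subseteq> \<Omega>" "\<And>x. x \<notin> L \<Longrightarrow> \<psi> x = 0"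
    using assms(2) by (auto simp: Cc1_def)
  show ?thesis unfolding Cc1_def
  proof (intro conjI allI exI[of _ "K \<union> L"])
    fix x show "((\<lambda>x. \<phi> x - \<psi> x) has_derivative (\<lambda>h. (D\<phi> x - D\<psi> x) \<bullet> h)) (at x)"
      using assms by (auto simp: Cc1_def inner_diff_left intro!: has_derivative_diff)
  qed (use K L assms in \<open>auto simp: Cc1_def intro!: continuous_intros\<close>)
qed

text \<open>Because \<open>\<theta>\<close> is C^1, the classical chain rule applies; the value 0 at
  0 keeps the composition zero outside the compact set.\<close>

lemma Cc1_compose:
  assumes \<phi>: "Cc1 \<Omega> \<phi> D\<phi>" and \<theta>: "\<And>s. (\<theta> has_real_derivative d\<theta> s) (at s)"
    "continuous_on UNIV d\<theta>" "\<theta> 0 = 0"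
  shows "Cc1 \<Omega> (\<lambda>x. \<theta> (\<phi> x)) (\<lambda>x. d\<theta> (\<phi> x) *\<^sub>R D\<phi> x)"
proof -
  obtain K where K: "compact K" "K \<subseteq> \<Omega>" "\<And>x. x \<notin> K \<Longrightarrow> \<phi> x = 0"
    using assms(1) by (auto simp: Cc1_def)
  note c = Cc1_continuous[OF \<phi>]
  show ?thesis unfolding Cc1_def
  proof (intro conjI allI exI[of _ K])
    fix x
    have "(\<phi> has_derivative (\<lambda>h. D\<phi> x \<bullet> h)) (at x)" using \<phi> by (simp add: Cc1_def)
    from has_derivative_compose[OF this \<theta>(1)[unfolded has_field_derivative_def]]
    show "((\<lambda>x. \<theta> (\<phi> x)) has_derivative (\<lambda>h. (d\<theta> (\<phi> x) *\<^sub>R D\<phi> x) \<bullet> h)) (at x)" by simp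
    have "continuous_on UNIV (\<lambda>x. d\<theta> (\<phi> x))"
      by (rule continuous_on_compose2[OF \<theta>(2) c(1)]) auto
    then show "continuous_on UNIV (\<lambda>x. d\<theta> (\<phi> x) *\<^sub>R D\<phi> x)"
      using c(2) by (intro continuous_intros)
  qed (use K \<theta>(3) in auto)
qed

lemma H01_measurable:
  assumes "p \<in> H01 \<Omega>"
  shows "fst p \<in> borel_measurable (lebesgue_on \<Omega>)" "snd p \<in> borel_measurable (lebesgue_on \<Omega>)"
    "fst p \<in> borel_measurable lebesgue" "snd p \<in> borel_measurable lebesgue"
  using assms by (auto simp: H01_def intro: measurable_restrict_space1)

lemma borel_measurable_lebesgue_on_I:
  "f \<in> borel_measurable borel \<Longrightarrow> f \<in> borel_measurable (lebesgue_on \<Omega>)"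
  by (intro measurable_restrict_space1 measurable_completion) simp

lemma H01_approx:
  fixes p :: "('a::euclidean_space \<Rightarrow> real) \<times> ('a \<Rightarrow> 'a)"
  assumes "p \<in> H01 \<Omega>" "\<Omega> \<in> sets lebesgue"
  shows "\<exists>\<phi> D\<phi>. (\<forall>k. Cc1 \<Omega> (\<phi> k) (D\<phi> k)) \<and>
      (\<lambda>k. \<integral>\<^sup>+x. ennreal ((\<phi> k x - fst p x)\<^sup>2) \<partial>lebesgue_on \<Omega>) \<longlonglongrightarrow> 0 \<and>
      (\<lambda>k. \<integral>\<^sup>+x. ennreal ((norm (D\<phi> k x - snd p x))\<^sup>2) \<partial>lebesgue_on \<Omega>) \<longlonglongrightarrow> 0"
  using assms by (simp add: H01_def set_nn_integral_lebesgue_on split_beta)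

lemma H01I:
  fixes p :: "('a::euclidean_space \<Rightarrow> real) \<times> ('a \<Rightarrow> 'a)"
  assumes "\<Omega> \<in> sets lebesgue" "fst p \<in> borel_measurable lebesgue" "snd p \<in> borel_measurable lebesgue"
    "\<And>k. Cc1 \<Omega> (\<phi> k) (D\<phi> k)"
    "(\<lambda>k. \<integral>\<^sup>+x. ennreal ((\<phi> k x - fst p x)\<^sup>2) \<partial>lebesgue_on \<Omega>) \<longlonglongrightarrow> 0"
    "(\<lambda>k. \<integral>\<^sup>+x. ennreal ((norm (D\<phi> k x - snd p x))\<^sup>2) \<partial>lebesgue_on \<Omega>) \<longlonglongrightarrow> 0"
  shows "p \<in> H01 \<Omega>"
  unfolding H01_def using assms
  by (auto simp: set_nn_integral_lebesgue_on split_beta intro!: exI[of _ \<phi>] exI[of _ D\<phi>])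

lemma Cc1_lebesgue_on:
  fixes \<phi> :: "'a::euclidean_space \<Rightarrow> real"
  assumes \<phi>: "Cc1 \<Omega> \<phi> D\<phi>" and \<Omega>: "\<Omega> \<in> sets lebesgue"
  shows "\<phi> \<in> borel_measurable (lebesgue_on \<Omega>)" "D\<phi> \<in> borel_measurable (lebesgue_on \<Omega>)"
    "(\<integral>\<^sup>+x. ennreal ((\<phi> x)\<^sup>2) \<partial>lebesgue_on \<Omega>) < \<infinity>"
    "(\<integral>\<^sup>+x. ennreal ((norm (D\<phi> x))\<^sup>2) \<partial>lebesgue_on \<Omega>) < \<infinity>"
proof -
  obtain K where K: "K \<subseteq> \<Omega>" "\<And>x. x \<notin> K \<Longrightarrow> \<phi> x = 0" "\<And>x. x \<notin> K \<Longrightarrow> D\<phi> x = 0"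
    using Cc1_support[OF \<phi>] by metis
  show "(\<integral>\<^sup>+x. ennreal ((\<phi> x)\<^sup>2) \<partial>lebesgue_on \<Omega>) < \<infinity>"
    by (subst nn_integral_lebesgue_on_supported[OF \<Omega>])
       (use K Cc1_L2_finite[OF \<phi>] in \<open>auto simp: nn_integral_eq_integral\<close>)
  show "(\<integral>\<^sup>+x. ennreal ((norm (D\<phi> x))\<^sup>2) \<partial>lebesgue_on \<Omega>) < \<infinity>"
    by (subst nn_integral_lebesgue_on_supported[OF \<Omega>])
       (use K Cc1_L2_finite[OF \<phi>] in \<open>auto simp: nn_integral_eq_integral\<close>)
qed (use Cc1_measurable[OF \<phi>] borel_measurable_lebesgue_on_I in blast)+

lemma H01_L2:
  fixes p :: "('a::euclidean_space \<Rightarrow> real) \<times> ('a \<Rightarrow> 'a)"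
  assumes p: "p \<in> H01 \<Omega>" and \<Omega>: "\<Omega> \<in> sets lebesgue"
  shows "(\<integral>\<^sup>+x. ennreal ((fst p x)\<^sup>2) \<partial>lebesgue_on \<Omega>) < \<infinity>"
    "(\<integral>\<^sup>+x. ennreal ((norm (snd p x))\<^sup>2) \<partial>lebesgue_on \<Omega>) < \<infinity>"
proof -
  obtain \<phi> D\<phi> where \<phi>: "\<And>k. Cc1 \<Omega> (\<phi> k) (D\<phi> k)"
    "(\<lambda>k. \<integral>\<^sup>+x. ennreal ((\<phi> k x - fst p x)\<^sup>2) \<partial>lebesgue_on \<Omega>) \<longlonglongrightarrow> 0"
    "(\<lambda>k. \<integral>\<^sup>+x. ennreal ((norm (D\<phi> k x - snd p x))\<^sup>2) \<partial>lebesgue_on \<Omega>) \<longlonglongrightarrow> 0"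
    using H01_approx[OF p \<Omega>] by blast
  note c = Cc1_lebesgue_on[OF \<phi>(1) \<Omega>]
  show "(\<integral>\<^sup>+x. ennreal ((fst p x)\<^sup>2) \<partial>lebesgue_on \<Omega>) < \<infinity>"
    using L2_finite_of_tendsto[of \<phi> "lebesgue_on \<Omega>" "fst p"] c \<phi>(2) H01_measurable[OF p] by simp
  show "(\<integral>\<^sup>+x. ennreal ((norm (snd p x))\<^sup>2) \<partial>lebesgue_on \<Omega>) < \<infinity>"
    using L2_finite_of_tendsto[of D\<phi> "lebesgue_on \<Omega>" "snd p"] c \<phi>(3) H01_measurable[OF p] by simp
qed

text \<open>Makes finiteness and the Poincare inequality available for differences, which is where
  the distance needs them.\<close>

lemma H01_diff:
  fixes p q :: "('a::euclidean_space \<Rightarrow> real) \<times> ('a \<Rightarrow> 'a)"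
  assumes p: "p \<in> H01 \<Omega>" and q: "q \<in> H01 \<Omega>" and \<Omega>: "\<Omega> \<in> sets lebesgue"
  shows "(\<lambda>x. fst p x - fst q x, \<lambda>x. snd p x - snd q x) \<in> H01 \<Omega>"
proof -
  obtain \<phi> D\<phi> where \<phi>: "\<And>k. Cc1 \<Omega> (\<phi> k) (D\<phi> k)"
    "(\<lambda>k. \<integral>\<^sup>+x. ennreal ((\<phi> k x - fst p x)\<^sup>2) \<partial>lebesgue_on \<Omega>) \<longlonglongrightarrow> 0"
    "(\<lambda>k. \<integral>\<^sup>+x. ennreal ((norm (D\<phi> k x - snd p x))\<^sup>2) \<partial>lebesgue_on \<Omega>) \<longlonglongrightarrow> 0"
    using H01_approx[OF p \<Omega>] by blast
  obtain \<psi> D\<psi> where \<psi>: "\<And>k. Cc1 \<Omega> (\<psi> k) (D\<psi> k)"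
    "(\<lambda>k. \<integral>\<^sup>+x. ennreal ((\<psi> k x - fst q x)\<^sup>2) \<partial>lebesgue_on \<Omega>) \<longlonglongrightarrow> 0"
    "(\<lambda>k. \<integral>\<^sup>+x. ennreal ((norm (D\<psi> k x - snd q x))\<^sup>2) \<partial>lebesgue_on \<Omega>) \<longlonglongrightarrow> 0"
    using H01_approx[OF q \<Omega>] by blast
  note m = Cc1_lebesgue_on[OF \<phi>(1) \<Omega>] Cc1_lebesgue_on[OF \<psi>(1) \<Omega>] H01_measurable[OF p] H01_measurable[OF q]
  show ?thesis
  proof (rule H01I[OF \<Omega>, where \<phi>="\<lambda>k x. \<phi> k x - \<psi> k x" and D\<phi>="\<lambda>k x. D\<phi> k x - D\<psi> k x"])
    show "Cc1 \<Omega> (\<lambda>x. \<phi> k x - \<psi> k x) (\<lambda>x. D\<phi> k x - D\<psi> k x)" for k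
      by (rule Cc1_diff[OF \<phi>(1) \<psi>(1)])
    show "(\<lambda>k. \<integral>\<^sup>+x. ennreal ((\<phi> k x - \<psi> k x - fst (\<lambda>x. fst p x - fst q x, \<lambda>x. snd p x - snd q x) x)\<^sup>2) \<partial>lebesgue_on \<Omega>) \<longlonglongrightarrow> 0"
      using L2_diff_tendsto[of \<phi> "lebesgue_on \<Omega>" "fst p" \<psi> "fst q"] m \<phi> \<psi> by simp
    show "(\<lambda>k. \<integral>\<^sup>+x. ennreal ((norm (D\<phi> k x - D\<psi> k x - snd (\<lambda>x. fst p x - fst q x, \<lambda>x. snd p x - snd q x) x))\<^sup>2) \<partial>lebesgue_on \<Omega>) \<longlonglongrightarrow> 0"
      using L2_diff_tendsto[of D\<phi> "lebesgue_on \<Omega>" "snd p" D\<psi> "snd q"] m \<phi> \<psi> by simp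
  qed (use m in auto)
qed

text \<open>Both sides of the inequality for test functions converge along an approximating
  sequence.\<close>

lemma H01_poincare:
  fixes p :: "('a::euclidean_space \<Rightarrow> real) \<times> ('a \<Rightarrow> 'a)"
  assumes p: "p \<in> H01 \<Omega>" and \<Omega>: "\<Omega> \<in> sets lebesgue" "\<Omega> \<subseteq> cball 0 B"
  shows "(\<integral>\<^sup>+x. ennreal ((fst p x)\<^sup>2) \<partial>lebesgue_on \<Omega>)
    \<le> ennreal (4 * B\<^sup>2) * (\<integral>\<^sup>+x. ennreal ((norm (snd p x))\<^sup>2) \<partial>lebesgue_on \<Omega>)"
proof -
  obtain \<phi> D\<phi> where \<phi>: "\<And>k. Cc1 \<Omega> (\<phi> k) (D\<phi> k)"
    "(\<lambda>k. \<integral>\<^sup>+x. ennreal ((\<phi> k x - fst p x)\<^sup>2) \<partial>lebesgue_on \<Omega>) \<longlonglongrightarrow> 0"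
    "(\<lambda>k. \<integral>\<^sup>+x. ennreal ((norm (D\<phi> k x - snd p x))\<^sup>2) \<partial>lebesgue_on \<Omega>) \<longlonglongrightarrow> 0"
    using H01_approx[OF p \<Omega>(1)] by blast
  note c = Cc1_lebesgue_on[OF \<phi>(1) \<Omega>(1)] H01_measurable[OF p] H01_L2[OF p \<Omega>(1)]
  have 1: "(\<lambda>k. \<integral>\<^sup>+x. ennreal ((\<phi> k x)\<^sup>2) \<partial>lebesgue_on \<Omega>) \<longlonglongrightarrow> (\<integral>\<^sup>+x. ennreal ((fst p x)\<^sup>2) \<partial>lebesgue_on \<Omega>)"
    using L2_norm_tendsto[of \<phi> "lebesgue_on \<Omega>" "fst p"] c \<phi>(2) by simp
  have 2: "(\<lambda>k. \<integral>\<^sup>+x. ennreal ((norm (D\<phi> k x))\<^sup>2) \<partial>lebesgue_on \<Omega>) \<longlonglongrightarrow> (\<integral>\<^sup>+x. ennreal ((norm (snd p x))\<^sup>2) \<partial>lebesgue_on \<Omega>)"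
    using L2_norm_tendsto[of D\<phi> "lebesgue_on \<Omega>" "snd p"] c \<phi>(3) by simp
  show ?thesis
    by (rule LIMSEQ_le[OF 1 ennreal_tendsto_cmult[OF _ 2, of "ennreal (4 * B\<^sup>2)"]])
       (use Cc1_poincare[OF \<Omega> \<phi>(1)] in auto)
qed

text \<open>\<open>enn2real\<close> sends infinity to 0, so the identity rests on finiteness of the
  integral, obtained from membership of the difference in \<open>H01\<close>.\<close>

lemma H01_dist_sq:
  fixes p q :: "('a::euclidean_space \<Rightarrow> real) \<times> ('a \<Rightarrow> 'a)"
  assumes p: "p \<in> H01 \<Omega>" and q: "q \<in> H01 \<Omega>" and \<Omega>: "\<Omega> \<in> sets lebesgue"
  shows "(\<integral>\<^sup>+x. ennreal ((norm (snd p x - snd q x))\<^sup>2) \<partial>lebesgue_on \<Omega>) = ennreal ((H01_dist \<Omega> p q)\<^sup>2)"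
  using H01_L2(2)[OF H01_diff[OF assms] \<Omega>]
  by (simp add: H01_dist_def set_nn_integral_lebesgue_on[OF \<Omega>] less_top[symmetric])

text \<open>The distance sees gradients only; the Poincare inequality on the bounded set recovers
  convergence of the functions themselves.\<close>

lemma H01_dist_tendsto_0_D:
  fixes p :: "nat \<Rightarrow> ('a::euclidean_space \<Rightarrow> real) \<times> ('a \<Rightarrow> 'a)"
  assumes p: "\<And>n. p n \<in> H01 \<Omega>" and q: "q \<in> H01 \<Omega>" and \<Omega>: "\<Omega> \<in> sets lebesgue" "bounded \<Omega>"
    and lim: "(\<lambda>n. H01_dist \<Omega> (p n) q) \<longlonglongrightarrow> 0"
  shows "(\<lambda>n. \<integral>\<^sup>+x. ennreal ((fst (p n) x - fst q x)\<^sup>2) \<partial>lebesgue_on \<Omega>) \<longlonglongrightarrow> 0"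
    "(\<lambda>n. \<integral>\<^sup>+x. ennreal ((norm (snd (p n) x - snd q x))\<^sup>2) \<partial>lebesgue_on \<Omega>) \<longlonglongrightarrow> 0"
proof -
  obtain B where B: "\<Omega> \<subseteq> cball 0 B" using \<Omega>(2) by (auto simp: bounded_iff subset_iff)
  have "(\<lambda>n. (H01_dist \<Omega> (p n) q)\<^sup>2) \<longlonglongrightarrow> 0\<^sup>2" by (intro tendsto_intros lim)
  then show 2: "(\<lambda>n. \<integral>\<^sup>+x. ennreal ((norm (snd (p n) x - snd q x))\<^sup>2) \<partial>lebesgue_on \<Omega>) \<longlonglongrightarrow> 0"
    unfolding H01_dist_sq[OF p q \<Omega>(1)] by (simp add: ennreal_tendsto_0_iff)
  have "(\<lambda>n. ennreal (4 * B\<^sup>2) * (\<integral>\<^sup>+x. ennreal ((norm (snd (p n) x - snd q x))\<^sup>2) \<partial>lebesgue_on \<Omega>)) \<longlonglongrightarrow> ennreal (4 * B\<^sup>2) * 0"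
    by (intro ennreal_tendsto_cmult 2) auto
  then have 3: "(\<lambda>n. ennreal (4 * B\<^sup>2) * (\<integral>\<^sup>+x. ennreal ((norm (snd (p n) x - snd q x))\<^sup>2) \<partial>lebesgue_on \<Omega>)) \<longlonglongrightarrow> 0" by simp
  show "(\<lambda>n. \<integral>\<^sup>+x. ennreal ((fst (p n) x - fst q x)\<^sup>2) \<partial>lebesgue_on \<Omega>) \<longlonglongrightarrow> 0"
    by (rule tendsto_sandwich[OF _ _ tendsto_const 3])
       (use H01_poincare[OF H01_diff[OF p q \<Omega>(1)] \<Omega>(1) B] in auto)
qed

lemma H01_dist_tendsto_0_I:
  fixes p :: "nat \<Rightarrow> ('a::euclidean_space \<Rightarrow> real) \<times> ('a \<Rightarrow> 'a)"
  assumes \<Omega>: "\<Omega> \<in> sets lebesgue"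
    and lim: "(\<lambda>n. \<integral>\<^sup>+x. ennreal ((norm (snd (p n) x - snd q x))\<^sup>2) \<partial>lebesgue_on \<Omega>) \<longlonglongrightarrow> 0"
  shows "(\<lambda>n. H01_dist \<Omega> (p n) q) \<longlonglongrightarrow> 0"
proof -
  have "(\<lambda>n. enn2real (\<integral>\<^sup>+x. ennreal ((norm (snd (p n) x - snd q x))\<^sup>2) \<partial>lebesgue_on \<Omega>)) \<longlonglongrightarrow> 0"
    using tendsto_enn2real[OF lim[folded ennreal_0]] by simp
  from tendsto_real_sqrt[OF this] show ?thesis
    by (simp add: H01_dist_def set_nn_integral_lebesgue_on[OF \<Omega>])
qed

text \<open>Multipliers bounded by 1 give the majorant 2 |g_n|^2 + 2 |g'|^2 for the squared error,
  so pointwise convergence along subsequences is enough. The multipliers may vary with n, as happens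
  when the deformation parameter moves together with the point. The lemma serves the chain rule, the
  continuity of the truncation error and that of the deformation.\<close>

lemma L2_multiplier_tendsto:
  fixes g :: "nat \<Rightarrow> 'a \<Rightarrow> 'b::euclidean_space" and c :: "nat \<Rightarrow> real \<Rightarrow> real"
  assumes [measurable]: "\<And>n. u n \<in> borel_measurable M" "u' \<in> borel_measurable M"
      "\<And>n. g n \<in> borel_measurable M" "g' \<in> borel_measurable M"
    and c: "\<And>n. continuous_on UNIV (c n)" "continuous_on UNIV c'" "\<And>n s. \<bar>c n s\<bar> \<le> 1" "\<And>s. \<bar>c' s\<bar> \<le> 1"
    and u: "(\<lambda>n. \<integral>\<^sup>+x. ennreal ((u n x - u' x)\<^sup>2) \<partial>M) \<longlonglongrightarrow> 0"
    and g: "(\<lambda>n. \<integral>\<^sup>+x. ennreal ((norm (g n x - g' x))\<^sup>2) \<partial>M) \<longlonglongrightarrow> 0"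
    and g': "(\<integral>\<^sup>+x. ennreal ((norm (g' x))\<^sup>2) \<partial>M) < \<infinity>"
    and conv: "\<And>r s s'. strict_mono r \<Longrightarrow> s \<longlonglongrightarrow> s' \<Longrightarrow> (\<lambda>n. c (r n) (s n)) \<longlonglongrightarrow> c' s'"
  shows "(\<lambda>n. \<integral>\<^sup>+x. ennreal ((norm (c n (u n x) *\<^sub>R g n x - c' (u' x) *\<^sub>R g' x))\<^sup>2) \<partial>M) \<longlonglongrightarrow> 0"
proof -
  have [measurable]: "c n \<in> borel_measurable borel" "c' \<in> borel_measurable borel" for n
    using c by (auto intro: borel_measurable_continuous_onI)
  have "(\<lambda>n. \<integral>\<^sup>+x. ennreal ((norm (c n (u n x) *\<^sub>R g n x - c' (u' x) *\<^sub>R g' x))\<^sup>2) \<partial>M) \<longlonglongrightarrow> (\<integral>\<^sup>+x. 0 \<partial>M)"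
  proof (rule nn_integral_tendsto_of_L2[where u=u and u'=u' and g=g and g'=g' and C=2
        and w="\<lambda>x. 2 * ennreal ((norm (g' x))\<^sup>2)"])
    show "(\<integral>\<^sup>+x. 2 * ennreal ((norm (g' x))\<^sup>2) \<partial>M) < \<infinity>"
      using g' by (simp add: nn_integral_cmult ennreal_mult_less_top)
  next
    fix n x
    have *: "(norm (a *\<^sub>R y))\<^sup>2 \<le> (norm y)\<^sup>2" if "\<bar>a\<bar> \<le> 1" for a and y :: 'b
      using that by (intro power_mono) (auto simp: mult_left_le_one_le)
    have "(norm (c n (u n x) *\<^sub>R g n x))\<^sup>2 \<le> (norm (g n x))\<^sup>2" "(norm (c' (u' x) *\<^sub>R g' x))\<^sup>2 \<le> (norm (g' x))\<^sup>2"
      by (intro * c)+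
    then have "(norm (c n (u n x) *\<^sub>R g n x - c' (u' x) *\<^sub>R g' x))\<^sup>2 \<le> 2 * (norm (g n x))\<^sup>2 + 2 * (norm (g' x))\<^sup>2"
      using norm_sum_sq_le[of "c n (u n x) *\<^sub>R g n x" "- (c' (u' x) *\<^sub>R g' x)"]
      unfolding norm_minus_cancel diff_conv_add_uminus by linarith
    from ennreal_leI[OF this]
    show "ennreal ((norm (c n (u n x) *\<^sub>R g n x - c' (u' x) *\<^sub>R g' x))\<^sup>2)
       \<le> ennreal (2 * (norm (g n x))\<^sup>2) + 2 * ennreal ((norm (g' x))\<^sup>2)"
      by (simp add: ennreal_mult)
  next
    fix r :: "nat \<Rightarrow> nat" and x
    assume r: "strict_mono r" "(\<lambda>n. u (r n) x) \<longlonglongrightarrow> u' x" "(\<lambda>n. g (r n) x) \<longlonglongrightarrow> g' x"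
    have "(\<lambda>n. (norm (c (r n) (u (r n) x) *\<^sub>R g (r n) x - c' (u' x) *\<^sub>R g' x))\<^sup>2)
        \<longlonglongrightarrow> (norm (c' (u' x) *\<^sub>R g' x - c' (u' x) *\<^sub>R g' x))\<^sup>2"
      by (intro tendsto_intros conv r)
    then show "(\<lambda>n. ennreal ((norm (c (r n) (u (r n) x) *\<^sub>R g (r n) x - c' (u' x) *\<^sub>R g' x))\<^sup>2)) \<longlonglongrightarrow> 0"
      by (simp add: ennreal_tendsto_0_iff)
  qed (use u g g' in auto)
  then show ?thesis by simp
qed

text \<open>Composing the approximating test functions with \<open>\<theta>\<close> again gives test
  functions. Their values converge because \<open>\<theta>\<close> is 1-Lipschitz, their gradients
  by the multiplier lemma.\<close>

lemma H01_compose: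
  fixes p :: "('a::euclidean_space \<Rightarrow> real) \<times> ('a \<Rightarrow> 'a)"
  assumes p: "p \<in> H01 \<Omega>" and \<Omega>: "\<Omega> \<in> sets lebesgue"
    and \<theta>: "\<And>s. (\<theta> has_real_derivative d\<theta> s) (at s)" "continuous_on UNIV d\<theta>" "\<theta> 0 = 0"
      "\<And>s. \<bar>d\<theta> s\<bar> \<le> 1"
  shows "(\<lambda>x. \<theta> (fst p x), \<lambda>x. d\<theta> (fst p x) *\<^sub>R snd p x) \<in> H01 \<Omega>"
proof -
  obtain \<phi> D\<phi> where \<phi>: "\<And>k. Cc1 \<Omega> (\<phi> k) (D\<phi> k)"
    "(\<lambda>k. \<integral>\<^sup>+x. ennreal ((\<phi> k x - fst p x)\<^sup>2) \<partial>lebesgue_on \<Omega>) \<longlonglongrightarrow> 0"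
    "(\<lambda>k. \<integral>\<^sup>+x. ennreal ((norm (D\<phi> k x - snd p x))\<^sup>2) \<partial>lebesgue_on \<Omega>) \<longlonglongrightarrow> 0"
    using H01_approx[OF p \<Omega>] by blast
  note m = Cc1_lebesgue_on[OF \<phi>(1) \<Omega>] H01_measurable[OF p]
  note [measurable] = H01_measurable[OF p]
  have "continuous_on UNIV \<theta>" using \<theta>(1) by (intro DERIV_continuous_on) (auto intro: has_field_derivative_at_within)
  then have [measurable]: "\<theta> \<in> borel_measurable borel" "d\<theta> \<in> borel_measurable borel"
    using \<theta>(2) by (auto intro: borel_measurable_continuous_onI)
  have lip: "\<bar>\<theta> a - \<theta> b\<bar> \<le> \<bar>a - b\<bar>" for a b
    using field_differentiable_bound[of UNIV \<theta> d\<theta> 1 a b] \<theta> by simp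
  show ?thesis
  proof (rule H01I[OF \<Omega>, where \<phi>="\<lambda>k x. \<theta> (\<phi> k x)" and D\<phi>="\<lambda>k x. d\<theta> (\<phi> k x) *\<^sub>R D\<phi> k x"])
    show "Cc1 \<Omega> (\<lambda>x. \<theta> (\<phi> k x)) (\<lambda>x. d\<theta> (\<phi> k x) *\<^sub>R D\<phi> k x)" for k
      by (rule Cc1_compose[OF \<phi>(1) \<theta>(1-3)])
    show "(\<lambda>k. \<integral>\<^sup>+x. ennreal ((\<theta> (\<phi> k x) - fst (\<lambda>x. \<theta> (fst p x), \<lambda>x. d\<theta> (fst p x) *\<^sub>R snd p x) x)\<^sup>2) \<partial>lebesgue_on \<Omega>) \<longlonglongrightarrow> 0"
      by (rule tendsto_sandwich[OF _ _ tendsto_const \<phi>(2)])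
         (auto intro!: always_eventually nn_integral_mono ennreal_leI simp: abs_le_square_iff[symmetric] lip)
    have "(\<lambda>n. \<integral>\<^sup>+x. ennreal ((norm (d\<theta> (\<phi> n x) *\<^sub>R D\<phi> n x - d\<theta> (fst p x) *\<^sub>R snd p x))\<^sup>2) \<partial>lebesgue_on \<Omega>) \<longlonglongrightarrow> 0"
      by (rule L2_multiplier_tendsto[of \<phi> _ "fst p" D\<phi> "snd p" "\<lambda>_. d\<theta>" d\<theta>])
         (use m \<phi> \<theta> H01_L2[OF p \<Omega>] continuous_on_tendsto_compose[OF \<theta>(2)] in auto)
    then show "(\<lambda>k. \<integral>\<^sup>+x. ennreal ((norm (d\<theta> (\<phi> k x) *\<^sub>R D\<phi> k x - snd (\<lambda>x. \<theta> (fst p x), \<lambda>x. d\<theta> (fst p x) *\<^sub>R snd p x) x))\<^sup>2) \<partial>lebesgue_on \<Omega>) \<longlonglongrightarrow> 0"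
      by simp
    show "fst (\<lambda>x. \<theta> (fst p x), \<lambda>x. d\<theta> (fst p x) *\<^sub>R snd p x) \<in> borel_measurable lebesgue"
      "snd (\<lambda>x. \<theta> (fst p x), \<lambda>x. d\<theta> (fst p x) *\<^sub>R snd p x) \<in> borel_measurable lebesgue"
      unfolding fst_conv snd_conv by measurable
  qed
qed

lemma H01_zero_in: "\<Omega> \<in> sets lebesgue \<Longrightarrow> (H01_zero :: ('a::euclidean_space \<Rightarrow> real) \<times> _) \<in> H01 \<Omega>"
  by (rule H01I[where \<phi>="\<lambda>_ _. 0" and D\<phi>="\<lambda>_ _. 0"]) (auto simp: H01_zero_def Cc1_def)

section \<open>Deformations of the epigraph\<close>

lemma tendsto_inverse_Suc_bound:
  fixes X :: "nat \<Rightarrow> real"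
  assumes "\<And>n. 0 \<le> X n" "\<And>n. X n < inverse (real (Suc n))"
  shows "X \<longlonglongrightarrow> 0"
  by (rule tendsto_sandwich[OF _ _ tendsto_const LIMSEQ_inverse_real_of_nat])
     (use assms in \<open>auto intro!: always_eventually less_imp_le\<close>)

text \<open>Stated for a bare nonnegative \<open>d\<close> because \<open>H01_dist\<close> vanishes
  between pairs that agree almost everywhere. A failure of continuity supplies a point within
  1/(n+1) for every n, hence a sequence contradicting the sequential hypothesis.\<close>

lemma dcont_sequentialI:
  assumes nonneg: "\<And>a b. 0 \<le> d a b"
    and lim: "\<And>p X. p \<in> S \<Longrightarrow> (\<And>n. X n \<in> S) \<Longrightarrow> (\<lambda>n. d (fst (X n)) (fst p)) \<longlonglongrightarrow> 0 \<Longrightarrow>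
        (\<lambda>n. snd (X n)) \<longlonglongrightarrow> snd p \<Longrightarrow> (\<lambda>n. d (H (X n)) (H p)) \<longlonglongrightarrow> 0"
  shows "dcont d S H"
  unfolding dcont_def
proof (intro ballI allI impI, rule ccontr)
  fix p and e :: real assume p: "p \<in> S" "e > 0"
  assume neg: "\<not> (\<exists>r>0. \<forall>q\<in>S. d (fst q) (fst p) + \<bar>snd q - snd p\<bar> < r \<longrightarrow> d (H q) (H p) < e)"
  have "\<exists>q\<in>S. d (fst q) (fst p) + \<bar>snd q - snd p\<bar> < inverse (real (Suc n)) \<and> \<not> d (H q) (H p) < e" for n
    using neg by (metis inverse_positive_iff_positive of_nat_0_less_iff zero_less_Suc)
  then obtain X where X: "\<And>n. X n \<in> S"
    "\<And>n. d (fst (X n)) (fst p) + \<bar>snd (X n) - snd p\<bar> < inverse (real (Suc n))"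
    "\<And>n. \<not> d (H (X n)) (H p) < e"
    by metis
  have X2: "d (fst (X n)) (fst p) < inverse (real (Suc n))" "\<bar>snd (X n) - snd p\<bar> < inverse (real (Suc n))" for n
    using X(2)[of n] nonneg[of "fst (X n)" "fst p"] by linarith+
  have "(\<lambda>n. d (fst (X n)) (fst p)) \<longlonglongrightarrow> 0"
    by (rule tendsto_inverse_Suc_bound[OF nonneg X2(1)])
  moreover have "(\<lambda>n. \<bar>snd (X n) - snd p\<bar>) \<longlonglongrightarrow> 0"
    by (rule tendsto_inverse_Suc_bound[OF abs_ge_zero X2(2)])
  then have "(\<lambda>n. snd (X n)) \<longlonglongrightarrow> snd p"
    by (simp add: tendsto_rabs_zero_iff LIM_zero_iff)
  ultimately have "(\<lambda>n. d (H (X n)) (H p)) \<longlonglongrightarrow> 0" using lim p(1) X(1) by blast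
  from order_tendstoD(2)[OF this p(2)] X(3) show False by (auto simp: eventually_sequentially)
qed

lemma epi_dist_bounds:
  "\<bar>snd p - snd q\<bar> \<le> epi_dist d p q" "d (fst p) (fst q) \<le> epi_dist d p q" "0 \<le> epi_dist d p q"
  by (auto simp: epi_dist_def intro!: real_le_rsqrt abs_le_square_iff[THEN iffD1, THEN order_trans] real_le_rsqrt)

text \<open>The deformations realise every rate strictly between 0 and 1, and the value 1 is reached
  only as their supremum.\<close>

lemma SUP_unit_interval:
  assumes "{0<..<1} \<subseteq> S" "\<And>\<sigma>. \<sigma> \<in> S \<Longrightarrow> \<sigma> \<le> 1"
  shows "(SUP \<sigma>\<in>S. ereal \<sigma>) = 1"
proof (rule antisym)
  show "(SUP \<sigma>\<in>S. ereal \<sigma>) \<le> 1" using assms(2) by (auto intro!: SUP_least)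
  show "1 \<le> (SUP \<sigma>\<in>S. ereal \<sigma>)"
  proof (rule dense_le)
    fix x :: ereal assume "x < 1"
    then obtain r where r: "x < ereal r" "ereal r < 1" using ereal_dense2 by blast
    \<comment> \<open>The number \<open>r\<close> may be negative; the maximum with 1/2 moves the
      witness into the open interval.\<close>
    have "x \<le> ereal (max r (1/2))" using r(1) by (auto intro: order_trans less_imp_le simp: max_def)
    also have "\<dots> \<le> (SUP \<sigma>\<in>S. ereal \<sigma>)"
      using r assms(1) by (intro SUP_upper) (auto simp: one_ereal_def subset_iff)
    finally show "x \<le> (SUP \<sigma>\<in>S. ereal \<sigma>)" .
  qed
qed

lemma H01_dist_commute: "H01_dist \<Omega> p q = H01_dist \<Omega> q p"
  by (simp add: H01_dist_def norm_minus_commute)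

lemma H01_dist_nonneg: "0 \<le> H01_dist \<Omega> p q"
  by (simp add: H01_dist_def)

lemma H01_dist_self: "H01_dist \<Omega> p p = 0"
  by (simp add: H01_dist_def)

text \<open>Turns a sequential statement at \<open>u\<close> into a radius: otherwise
  counterexamples at distance below 1/(n+1) would form a sequence converging to
  \<open>u\<close>.\<close>

lemma H01_neighbourhood:
  assumes "\<And>X. (\<And>n. X n \<in> H01 \<Omega>) \<Longrightarrow> (\<lambda>n. H01_dist \<Omega> (X n) u) \<longlonglongrightarrow> 0 \<Longrightarrow> \<forall>\<^sub>F n in sequentially. P (X n)"
  obtains \<delta> where "\<delta> > 0" "\<And>v. v \<in> H01 \<Omega> \<Longrightarrow> H01_dist \<Omega> u v < \<delta> \<Longrightarrow> P v"
proof (rule ccontr)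
  assume "\<not> thesis"
  then have neg: "\<not> (\<exists>\<delta>>0. \<forall>v\<in>H01 \<Omega>. H01_dist \<Omega> u v < \<delta> \<longrightarrow> P v)" using that by blast
  have "\<exists>v\<in>H01 \<Omega>. H01_dist \<Omega> u v < inverse (real (Suc n)) \<and> \<not> P v" for n
    using neg by (metis inverse_positive_iff_positive of_nat_0_less_iff zero_less_Suc)
  then obtain X where X: "\<And>n. X n \<in> H01 \<Omega>" "\<And>n. H01_dist \<Omega> u (X n) < inverse (real (Suc n))" "\<And>n. \<not> P (X n)"
    by metis
  have "(\<lambda>n. H01_dist \<Omega> (X n) u) \<longlonglongrightarrow> 0"
    using tendsto_inverse_Suc_bound[OF H01_dist_nonneg X(2)] by (simp add: H01_dist_commute[of _ _ u])
  from assms[OF X(1) this] X(3) show False by (auto simp: eventually_sequentially)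
qed

section \<open>Deformation by truncation and the length of its displacement\<close>

definition deform :: "real \<Rightarrow> real \<Rightarrow> ('a \<Rightarrow> real) \<times> ('a \<Rightarrow> 'a::euclidean_space) \<Rightarrow> ('a \<Rightarrow> real) \<times> ('a \<Rightarrow> 'a)" where
  "deform K \<tau> p = (\<lambda>x. (1 - \<tau>) * fst p x + \<tau> * trunc K (fst p x),
                   \<lambda>x. (1 - \<tau> + \<tau> * dtrunc K (fst p x)) *\<^sub>R snd p x)"

text \<open>Oddness of \<open>trunc\<close> and evenness of \<open>dtrunc\<close> make the
  deformation equivariant.\<close>

lemma deform_neg: "deform K \<tau> (H01_neg p) = H01_neg (deform K \<tau> p)"
  by (simp add: deform_def H01_neg_def trunc_minus fun_eq_iff algebra_simps)

lemma convex_factor_bounds: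
  assumes "0 \<le> \<tau>" "\<tau> \<le> 1" "K \<ge> 0"
  shows "0 \<le> 1 - \<tau> + \<tau> * dtrunc K s" "1 - \<tau> + \<tau> * dtrunc K s \<le> 1"
proof -
  have "0 \<le> \<tau> * dtrunc K s" "\<tau> * dtrunc K s \<le> \<tau> * 1"
    using assms dtrunc_bounds[of K s] by (intro mult_nonneg_nonneg mult_left_mono; simp)+
  then show "0 \<le> 1 - \<tau> + \<tau> * dtrunc K s" "1 - \<tau> + \<tau> * dtrunc K s \<le> 1" using assms by linarith+
qed

text \<open>For fixed \<open>\<tau>\<close> the deformation is composition with a C^1 function that
  fixes 0 and has slope in [0, 1], so the chain rule applies, with the second component as
  gradient.\<close>

lemma deform_in_H01:
  fixes p :: "('a::euclidean_space \<Rightarrow> real) \<times> ('a \<Rightarrow> 'a)"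
  assumes "p \<in> H01 \<Omega>" "\<Omega> \<in> sets lebesgue" "0 \<le> \<tau>" "\<tau> \<le> 1" "K \<ge> 0"
  shows "deform K \<tau> p \<in> H01 \<Omega>"
  unfolding deform_def
proof (rule H01_compose[OF assms(1,2), of "\<lambda>s. (1 - \<tau>) * s + \<tau> * trunc K s" "\<lambda>s. 1 - \<tau> + \<tau> * dtrunc K s"])
  fix s
  show "((\<lambda>s. (1 - \<tau>) * s + \<tau> * trunc K s) has_real_derivative 1 - \<tau> + \<tau> * dtrunc K s) (at s)"
    by (auto intro!: derivative_eq_intros trunc_deriv)
  show "\<bar>1 - \<tau> + \<tau> * dtrunc K s\<bar> \<le> 1" using convex_factor_bounds[OF assms(3-5), of s] by simp
qed (auto intro!: continuous_intros continuous_dtrunc simp: trunc_inside assms)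

text \<open>The squared gradient norm of \<open>p\<close> minus its truncation, that is, the squared
  speed of the deformation in \<open>\<tau>\<close>.\<close>

definition trunc_defect :: "'a set \<Rightarrow> real \<Rightarrow> ('a \<Rightarrow> real) \<times> ('a \<Rightarrow> 'a::euclidean_space) \<Rightarrow> ennreal" where
  "trunc_defect \<Omega> K p = (\<integral>\<^sup>+x. ennreal ((norm ((1 - dtrunc K (fst p x)) *\<^sub>R snd p x))\<^sup>2) \<partial>lebesgue_on \<Omega>)"

text \<open>The gradient moves along a straight line in \<open>\<tau>\<close>, so the displacement
  is exactly proportional to \<open>\<tau>\<close>.\<close>

lemma deform_dist:
  fixes p :: "('a::euclidean_space \<Rightarrow> real) \<times> ('a \<Rightarrow> 'a)"
  assumes p: "p \<in> H01 \<Omega>" and \<Omega>: "\<Omega> \<in> sets lebesgue" and "0 \<le> \<tau>"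
  shows "H01_dist \<Omega> (deform K \<tau> p) p = \<tau> * sqrt (enn2real (trunc_defect \<Omega> K p))"
proof -
  note [measurable] = H01_measurable[OF p]
  have [measurable]: "dtrunc K \<in> borel_measurable borel"
    by (intro borel_measurable_continuous_onI continuous_dtrunc)
  have eq: "norm (snd (deform K \<tau> p) x - snd p x) = \<tau> * norm ((1 - dtrunc K (fst p x)) *\<^sub>R snd p x)" for x
  proof -
    have "snd (deform K \<tau> p) x - snd p x = (- \<tau>) *\<^sub>R ((1 - dtrunc K (fst p x)) *\<^sub>R snd p x)"
      by (simp add: deform_def algebra_simps)
    then show ?thesis using assms(3) by (metis abs_minus_cancel abs_of_nonneg norm_scaleR)
  qed
  have "(\<integral>\<^sup>+x. ennreal ((norm (snd (deform K \<tau> p) x - snd p x))\<^sup>2) \<partial>lebesgue_on \<Omega>) = ennreal (\<tau>\<^sup>2) * trunc_defect \<Omega> K p"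
    unfolding eq trunc_defect_def power_mult_distrib
    by (subst nn_integral_cmult[symmetric]) (auto simp: ennreal_mult)
  then show ?thesis
    using assms(3) by (simp add: H01_dist_def set_nn_integral_lebesgue_on[OF \<Omega>] enn2real_mult real_sqrt_mult)
qed

lemma trunc_defect_finite:
  fixes p :: "('a::euclidean_space \<Rightarrow> real) \<times> ('a \<Rightarrow> 'a)"
  assumes p: "p \<in> H01 \<Omega>" and \<Omega>: "\<Omega> \<in> sets lebesgue" and K: "K \<ge> 0"
  shows "trunc_defect \<Omega> K p < \<infinity>"
proof -
  have "trunc_defect \<Omega> K p \<le> (\<integral>\<^sup>+x. ennreal ((norm (snd p x))\<^sup>2) \<partial>lebesgue_on \<Omega>)"
    unfolding trunc_defect_def
  proof (intro nn_integral_mono ennreal_leI power_mono)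
    fix x
    have "\<bar>1 - dtrunc K (fst p x)\<bar> \<le> 1" using dtrunc_bounds[of K "fst p x"] K by auto
    then show "norm ((1 - dtrunc K (fst p x)) *\<^sub>R snd p x) \<le> norm (snd p x)" by (simp add: mult_left_le_one_le)
  qed simp
  also have "\<dots> < \<infinity>" by (rule H01_L2(2)[OF p \<Omega>])
  finally show ?thesis .
qed

text \<open>At each point the integrand vanishes as soon as k exceeds the absolute value of the
  function there, and the squared gradient is a majorant.\<close>

lemma trunc_defect_tendsto_0:
  fixes p :: "('a::euclidean_space \<Rightarrow> real) \<times> ('a \<Rightarrow> 'a)"
  assumes p: "p \<in> H01 \<Omega>" and \<Omega>: "\<Omega> \<in> sets lebesgue"
  shows "(\<lambda>k. trunc_defect \<Omega> (real k) p) \<longlonglongrightarrow> 0"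
proof -
  note [measurable] = H01_measurable[OF p]
  have [measurable]: "dtrunc K \<in> borel_measurable borel" for K
    by (intro borel_measurable_continuous_onI continuous_dtrunc)
  have "(\<lambda>k. trunc_defect \<Omega> (real k) p) \<longlonglongrightarrow> (\<integral>\<^sup>+x. 0 \<partial>lebesgue_on \<Omega>)"
    unfolding trunc_defect_def
  proof (rule nn_integral_dominated_convergence[where w="\<lambda>x. ennreal ((norm (snd p x))\<^sup>2)"])
    show "AE x in lebesgue_on \<Omega>. ennreal ((norm ((1 - dtrunc (real k) (fst p x)) *\<^sub>R snd p x))\<^sup>2)
        \<le> ennreal ((norm (snd p x))\<^sup>2)" for k
    proof (intro AE_I2 ennreal_leI power_mono)
      fix x
      have "\<bar>1 - dtrunc k (fst p x)\<bar> \<le> 1" using dtrunc_bounds[of k "fst p x"] by auto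
      then show "norm ((1 - dtrunc k (fst p x)) *\<^sub>R snd p x) \<le> norm (snd p x)" by (simp add: mult_left_le_one_le)
    qed simp
    show "AE x in lebesgue_on \<Omega>. (\<lambda>k. ennreal ((norm ((1 - dtrunc (real k) (fst p x)) *\<^sub>R snd p x))\<^sup>2)) \<longlonglongrightarrow> 0"
    proof (rule AE_I2)
      fix x
      obtain k0 :: nat where k0: "\<bar>fst p x\<bar> \<le> real k0" using real_arch_simple by blast
      have "\<forall>\<^sub>F k in sequentially. ennreal ((norm ((1 - dtrunc (real k) (fst p x)) *\<^sub>R snd p x))\<^sup>2) = 0"
        using eventually_ge_at_top[of k0] by eventually_elim (use k0 in \<open>simp add: dtrunc_inside\<close>)
      then show "(\<lambda>k. ennreal ((norm ((1 - dtrunc (real k) (fst p x)) *\<^sub>R snd p x))\<^sup>2)) \<longlonglongrightarrow> 0"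
        by (rule tendsto_eventually)
    qed
  qed (use H01_L2(2)[OF p \<Omega>] in auto)
  then show ?thesis by simp
qed

text \<open>With \<open>K\<close> fixed, a strict bound on the defect at one point persists nearby;
  this is what makes the displacement estimate uniform on a ball.\<close>

lemma trunc_defect_continuous:
  fixes p :: "nat \<Rightarrow> ('a::euclidean_space \<Rightarrow> real) \<times> ('a \<Rightarrow> 'a)"
  assumes p: "\<And>n. p n \<in> H01 \<Omega>" and q: "q \<in> H01 \<Omega>" and \<Omega>: "\<Omega> \<in> sets lebesgue" "bounded \<Omega>" and K: "K \<ge> 0"
    and lim: "(\<lambda>n. H01_dist \<Omega> (p n) q) \<longlonglongrightarrow> 0"
  shows "(\<lambda>n. trunc_defect \<Omega> K (p n)) \<longlonglongrightarrow> trunc_defect \<Omega> K q"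
proof -
  note [measurable] = H01_measurable[OF p] H01_measurable[OF q]
  have [measurable]: "dtrunc K \<in> borel_measurable borel"
    by (intro borel_measurable_continuous_onI continuous_dtrunc)
  have b: "\<bar>1 - dtrunc K s\<bar> \<le> 1" for s using dtrunc_bounds[of K s] K by auto
  have c: "continuous_on UNIV (\<lambda>s. 1 - dtrunc K s)" by (intro continuous_intros continuous_dtrunc)
  have "(\<lambda>n. \<integral>\<^sup>+x. ennreal ((norm ((1 - dtrunc K (fst (p n) x)) *\<^sub>R snd (p n) x - (1 - dtrunc K (fst q x)) *\<^sub>R snd q x))\<^sup>2) \<partial>lebesgue_on \<Omega>) \<longlonglongrightarrow> 0"
    by (rule L2_multiplier_tendsto[of "\<lambda>n. fst (p n)" _ "fst q" "\<lambda>n. snd (p n)" "snd q" "\<lambda>_ s. 1 - dtrunc K s" "\<lambda>s. 1 - dtrunc K s"])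
       (use b c H01_dist_tendsto_0_D[OF p q \<Omega> lim] H01_L2(2)[OF q \<Omega>(1)] continuous_on_tendsto_compose[OF c] in auto)
  then show ?thesis
    unfolding trunc_defect_def
    by (intro L2_norm_tendsto) (use trunc_defect_finite[OF q \<Omega>(1) K] in \<open>auto simp: trunc_defect_def\<close>)
qed

text \<open>Joint continuity in the parameter and the point, through multipliers that depend on n by
  way of \<open>\<tau> n\<close>.\<close>

lemma deform_continuous:
  fixes p :: "nat \<Rightarrow> ('a::euclidean_space \<Rightarrow> real) \<times> ('a \<Rightarrow> 'a)"
  assumes p: "\<And>n. p n \<in> H01 \<Omega>" and q: "q \<in> H01 \<Omega>" and \<Omega>: "\<Omega> \<in> sets lebesgue" "bounded \<Omega>" and K: "K \<ge> 0"
    and lim: "(\<lambda>n. H01_dist \<Omega> (p n) q) \<longlonglongrightarrow> 0"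
    and \<tau>: "\<And>n. 0 \<le> \<tau> n" "\<And>n. \<tau> n \<le> 1" "0 \<le> \<tau>'" "\<tau>' \<le> 1" "\<tau> \<longlonglongrightarrow> \<tau>'"
  shows "(\<lambda>n. H01_dist \<Omega> (deform K (\<tau> n) (p n)) (deform K \<tau>' q)) \<longlonglongrightarrow> 0"
proof (rule H01_dist_tendsto_0_I[OF \<Omega>(1)])
  note m = H01_measurable[OF p] H01_measurable[OF q]
  have c: "continuous_on UNIV (\<lambda>s. 1 - t + t * dtrunc K s)" for t by (intro continuous_intros continuous_dtrunc)
  have b: "\<bar>1 - t + t * dtrunc K s\<bar> \<le> 1" if "0 \<le> t" "t \<le> 1" for t s
    using convex_factor_bounds[OF that K, of s] by auto
  have "(\<lambda>n. \<integral>\<^sup>+x. ennreal ((norm ((1 - \<tau> n + \<tau> n * dtrunc K (fst (p n) x)) *\<^sub>R snd (p n) x - (1 - \<tau>' + \<tau>' * dtrunc K (fst q x)) *\<^sub>R snd q x))\<^sup>2) \<partial>lebesgue_on \<Omega>) \<longlonglongrightarrow> 0"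
  proof (rule L2_multiplier_tendsto[of "\<lambda>n. fst (p n)" _ "fst q" "\<lambda>n. snd (p n)" "snd q" "\<lambda>n s. 1 - \<tau> n + \<tau> n * dtrunc K s" "\<lambda>s. 1 - \<tau>' + \<tau>' * dtrunc K s"])
    fix r :: "nat \<Rightarrow> nat" and s :: "nat \<Rightarrow> real" and s' :: real assume r: "strict_mono r" "s \<longlonglongrightarrow> s'"
    have "(\<lambda>n. \<tau> (r n)) \<longlonglongrightarrow> \<tau>'" using LIMSEQ_subseq_LIMSEQ[OF \<tau>(5) r(1)] by (simp add: o_def)
    moreover have "(\<lambda>n. dtrunc K (s n)) \<longlonglongrightarrow> dtrunc K s'"
      using continuous_on_tendsto_compose[OF continuous_dtrunc r(2)] by simp
    ultimately show "(\<lambda>n. 1 - \<tau> (r n) + \<tau> (r n) * dtrunc K (s n)) \<longlonglongrightarrow> 1 - \<tau>' + \<tau>' * dtrunc K s'"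
      by (intro tendsto_intros)
  qed (use b c \<tau> m H01_dist_tendsto_0_D[OF p q \<Omega> lim] H01_L2(2)[OF q \<Omega>(1)] in auto)
  then show "(\<lambda>n. \<integral>\<^sup>+x. ennreal ((norm (snd (deform K (\<tau> n) (p n)) x - snd (deform K \<tau>' q) x))\<^sup>2) \<partial>lebesgue_on \<Omega>) \<longlonglongrightarrow> 0"
    by (simp add: deform_def)
qed

text \<open>The conditions hold at every x and are all satisfied by the zero integrand, so an
  integrand with almost-everywhere properties fits after being set to 0 on a null set. Convexity
  survives as the inequality \<open>star\<close> along rays from 0, and the sign condition on the
  s-derivative as the two monotonicity statements beyond \<open>R\<close>.\<close>

locale regular_integrand =
  fixes \<Omega> :: "'a::euclidean_space set" and f :: "'a \<Rightarrow> real \<Rightarrow> 'a \<Rightarrow> real" and \<alpha> :: "real \<Rightarrow> real" and R :: real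
  assumes domain: "\<Omega> \<in> sets lebesgue" "bounded \<Omega>"
    and meas: "\<And>s \<xi>. (\<lambda>x. f x s \<xi>) \<in> borel_measurable (lebesgue_on \<Omega>)"
    and cont: "\<And>x. continuous_on UNIV (\<lambda>p. f x (fst p) (snd p))"
    and star: "\<And>x s \<xi> c. 0 \<le> c \<Longrightarrow> c \<le> 1 \<Longrightarrow> f x s (c *\<^sub>R \<xi>) \<le> c * f x s \<xi>"
    and nonneg: "\<And>x s \<xi>. 0 \<le> f x s \<xi>"
    and upper: "\<And>x s \<xi>. f x s \<xi> \<le> \<alpha> \<bar>s\<bar> * (norm \<xi>)\<^sup>2"
    and \<alpha>_mono: "mono_on {0..} \<alpha>"
    and R_pos: "R > 0"
    and incr: "\<And>x s t \<xi>. R \<le> s \<Longrightarrow> s \<le> t \<Longrightarrow> f x s \<xi> \<le> f x t \<xi>"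
    and decr: "\<And>x s t \<xi>. R \<le> s \<Longrightarrow> s \<le> t \<Longrightarrow> f x (- s) \<xi> \<le> f x (- t) \<xi>"
begin

section \<open>Energy along the deformation\<close>

definition energy :: "('a \<Rightarrow> real) \<times> ('a \<Rightarrow> 'a) \<Rightarrow> ennreal" where
  "energy p = (\<integral>\<^sup>+x. ennreal (f x (fst p x) (snd p x)) \<partial>lebesgue_on \<Omega>)"

definition cut_energy :: "real \<Rightarrow> ('a \<Rightarrow> real) \<times> ('a \<Rightarrow> 'a) \<Rightarrow> ennreal" where
  "cut_energy K p = (\<integral>\<^sup>+x. ennreal (dtrunc K (fst p x) * f x (fst p x) (snd p x)) \<partial>lebesgue_on \<Omega>)"

lemma Jfun_energy: "Jfun \<Omega> f p = enn2ereal (energy p)"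
  by (simp add: Jfun_def energy_def set_nn_integral_lebesgue_on domain)

lemma measurable_integrand:
  assumes p: "p \<in> H01 \<Omega>"
  shows "(\<lambda>x. f x (fst p x) (snd p x)) \<in> borel_measurable (lebesgue_on \<Omega>)"
proof -
  have "(\<lambda>x. (fst p x, snd p x)) \<in> borel_measurable (lebesgue_on \<Omega>)"
    using H01_measurable[OF p] by (intro borel_measurable_Pair)
  from borel_measurable_caratheodory[of _ _ "\<lambda>x z. f x (fst z) (snd z)", OF this]
  show ?thesis using meas cont by simp
qed

lemma cut_energy_le: "K \<ge> 0 \<Longrightarrow> cut_energy K p \<le> energy p"
  unfolding cut_energy_def energy_def
  by (intro nn_integral_mono ennreal_leI mult_left_le_one_le nonneg dtrunc_bounds)

text \<open>On \<open>\<bar>s\<bar> \<le> K + 1\<close> monotonicity of \<open>\<alpha>\<close>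
  gives a quadratic bound with the fixed coefficient \<open>\<alpha> (K + 1)\<close>, and beyond
  that \<open>dtrunc K\<close> vanishes. Hence the general convergence theorem applies.\<close>

lemma cut_energy_continuous:
  assumes p: "\<And>n. p n \<in> H01 \<Omega>" and q: "q \<in> H01 \<Omega>" and K: "K \<ge> 0"
    and lim: "(\<lambda>n. H01_dist \<Omega> (p n) q) \<longlonglongrightarrow> 0"
  shows "(\<lambda>n. cut_energy K (p n)) \<longlonglongrightarrow> cut_energy K q"
proof -
  note [measurable] = H01_measurable[OF p] H01_measurable[OF q] measurable_integrand[OF p] measurable_integrand[OF q]
  have [measurable]: "dtrunc K \<in> borel_measurable borel"
    by (intro borel_measurable_continuous_onI continuous_dtrunc)
  show ?thesis
    unfolding cut_energy_def
  proof (rule nn_integral_tendsto_of_L2[where u="\<lambda>n. fst (p n)" and u'="fst q" and g="\<lambda>n. snd (p n)" and g'="snd q"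
        and C="\<alpha> (K + 1)" and w="\<lambda>_. 0"])
    fix n x
    let ?s = "fst (p n) x" and ?g = "snd (p n) x"
    have "dtrunc K ?s * f x ?s ?g \<le> \<alpha> (K + 1) * (norm ?g)\<^sup>2"
    proof (cases "\<bar>?s\<bar> \<le> K + 1")
      case True
      have "dtrunc K ?s * f x ?s ?g \<le> f x ?s ?g"
        by (intro mult_left_le_one_le nonneg dtrunc_bounds K)
      also have "\<dots> \<le> \<alpha> \<bar>?s\<bar> * (norm ?g)\<^sup>2" by (rule upper)
      also have "\<dots> \<le> \<alpha> (K + 1) * (norm ?g)\<^sup>2"
        using True by (intro mult_right_mono mono_onD[OF \<alpha>_mono]) auto
      finally show ?thesis .
    next
      case False
      \<comment> \<open>The locale states no sign for \<open>\<alpha>\<close>; the product is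
        nonnegative because it bounds the nonnegative integrand at s = K + 1.\<close>
      have "0 \<le> \<alpha> \<bar>K + 1\<bar> * (norm ?g)\<^sup>2"
        using upper[of x "K + 1" ?g] nonneg[of x "K + 1" ?g] by linarith
      then show ?thesis using False K by (simp add: dtrunc_outside)
    qed
    then show "ennreal (dtrunc K ?s * f x ?s ?g) \<le> ennreal (\<alpha> (K + 1) * (norm ?g)\<^sup>2) + 0"
      by (simp add: ennreal_leI)
  next
    fix r :: "nat \<Rightarrow> nat" and x
    assume r: "(\<lambda>n. fst (p (r n)) x) \<longlonglongrightarrow> fst q x" "(\<lambda>n. snd (p (r n)) x) \<longlonglongrightarrow> snd q x"
    have "(\<lambda>n. dtrunc K (fst (p (r n)) x)) \<longlonglongrightarrow> dtrunc K (fst q x)"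
      using continuous_on_tendsto_compose[OF continuous_dtrunc r(1)] by simp
    moreover have "(\<lambda>n. f x (fst (p (r n)) x) (snd (p (r n)) x)) \<longlonglongrightarrow> f x (fst q x) (snd q x)"
      using continuous_on_tendsto_compose[OF cont[of x] tendsto_Pair[OF r]] by simp
    ultimately show "(\<lambda>n. ennreal (dtrunc K (fst (p (r n)) x) * f x (fst (p (r n)) x) (snd (p (r n)) x)))
        \<longlonglongrightarrow> ennreal (dtrunc K (fst q x) * f x (fst q x) (snd q x))"
      by (intro tendsto_ennrealI tendsto_mult)
  qed (use H01_dist_tendsto_0_D[OF p q domain lim] H01_L2(2)[OF q domain(1)] in auto)
qed

text \<open>On \<open>{\<bar>s\<bar> \<le> K}\<close> the deformation does nothing; elsewhere it moves \<open>s\<close> towards \<open>0\<close> while keeping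
  \<open>\<bar>s\<bar> \<ge> K \<ge> R\<close>, where the sign condition makes the integrand decrease.\<close>
lemma integrand_deform_le:
  assumes "K \<ge> R" "0 \<le> \<tau>" "\<tau> \<le> 1"
  shows "f x ((1 - \<tau>) * s + \<tau> * trunc K s) ((1 - \<tau> + \<tau> * dtrunc K s) *\<^sub>R \<xi>)
    \<le> (1 - \<tau>) * f x s \<xi> + \<tau> * (dtrunc K s * f x s \<xi>)"
proof -
  have K: "K \<ge> 0" using assms R_pos by linarith
  let ?z = "(1 - \<tau>) * s + \<tau> * trunc K s" and ?c = "1 - \<tau> + \<tau> * dtrunc K s"
  have conv: "K \<le> (1 - \<tau>) * a + \<tau> * trunc K a \<and> (1 - \<tau>) * a + \<tau> * trunc K a \<le> a" if "a \<ge> K" for a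
  proof
    have "(1 - \<tau>) * K + \<tau> * K \<le> (1 - \<tau>) * a + \<tau> * trunc K a"
      using assms trunc_bounds[OF K that] that by (intro add_mono mult_left_mono) auto
    then show "K \<le> (1 - \<tau>) * a + \<tau> * trunc K a" by (simp add: algebra_simps)
    have "(1 - \<tau>) * a + \<tau> * trunc K a \<le> (1 - \<tau>) * a + \<tau> * a"
      using assms trunc_bounds[OF K that] by (intro add_mono mult_left_mono) auto
    then show "(1 - \<tau>) * a + \<tau> * trunc K a \<le> a" by (simp add: algebra_simps)
  qed
  have "f x ?z \<xi> \<le> f x s \<xi>"
  proof -
    consider "\<bar>s\<bar> \<le> K" | "s \<ge> K" | "- s \<ge> K" by linarith
    then show ?thesis
    proof cases
      case 1 then show ?thesis by (simp add: trunc_inside algebra_simps)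
    next
      case 2 then show ?thesis using conv[of s] assms by (intro incr) auto
    next
      case 3
      have "f x (- ((1 - \<tau>) * (- s) + \<tau> * trunc K (- s))) \<xi> \<le> f x (- (- s)) \<xi>"
        using conv[OF 3] assms by (intro decr) auto
      then show ?thesis by (simp add: trunc_minus algebra_simps)
    qed
  qed
  note c = convex_factor_bounds[OF assms(2,3) K, of s]
  \<comment> \<open>Convexity enters here: shrinking the gradient by \<open>?c\<close> gains the
    factor \<open>?c\<close>, and expanding it splits the bound into the full and the cut
    integrand.\<close>
  have "f x ?z (?c *\<^sub>R \<xi>) \<le> ?c * f x ?z \<xi>" by (rule star[OF c])
  also have "\<dots> \<le> ?c * f x s \<xi>" by (rule mult_left_mono) fact+
  finally show ?thesis by (simp add: algebra_simps)
qed

lemma energy_deform_le: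
  assumes p: "p \<in> H01 \<Omega>" and K: "K \<ge> R" and \<tau>: "0 \<le> \<tau>" "\<tau> \<le> 1"
  shows "energy (deform K \<tau> p) \<le> ennreal (1 - \<tau>) * energy p + ennreal \<tau> * cut_energy K p"
proof -
  note [measurable] = H01_measurable[OF p] measurable_integrand[OF p]
  have [measurable]: "dtrunc K \<in> borel_measurable borel"
    by (intro borel_measurable_continuous_onI continuous_dtrunc)
  have K0: "K \<ge> 0" using K R_pos by linarith
  have "energy (deform K \<tau> p) \<le> (\<integral>\<^sup>+x. ennreal (1 - \<tau>) * ennreal (f x (fst p x) (snd p x))
       + ennreal \<tau> * ennreal (dtrunc K (fst p x) * f x (fst p x) (snd p x)) \<partial>lebesgue_on \<Omega>)"
    unfolding energy_def
  proof (rule nn_integral_mono)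
    fix x
    have n: "0 \<le> dtrunc K (fst p x) * f x (fst p x) (snd p x)"
      by (intro mult_nonneg_nonneg dtrunc_bounds nonneg K0)
    show "ennreal (f x (fst (deform K \<tau> p) x) (snd (deform K \<tau> p) x)) \<le> ennreal (1 - \<tau>) * ennreal (f x (fst p x) (snd p x))
       + ennreal \<tau> * ennreal (dtrunc K (fst p x) * f x (fst p x) (snd p x))"
      using integrand_deform_le[OF K \<tau>, of x "fst p x" "snd p x"] \<tau> nonneg n
      by (simp add: deform_def ennreal_mult[symmetric] ennreal_plus[symmetric] ennreal_leI del: ennreal_plus)
  qed
  also have "\<dots> = ennreal (1 - \<tau>) * energy p + ennreal \<tau> * cut_energy K p"
    unfolding energy_def cut_energy_def by (subst nn_integral_add; (subst nn_integral_cmult)?; simp add: nn_integral_cmult)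
  finally show ?thesis .
qed

text \<open>One construction for both slopes, with parameter
  \<open>\<tau> = \<sigma> * t / \<gamma>\<close>: the convexity estimate frees at least
  \<open>\<tau> * \<gamma> = \<sigma> * t\<close> of height. The deformation is given by a global
  formula, so the oddness clause holds even when the negative of \<open>w\<close> leaves the
  ball.\<close>

lemma epigraph_deformation:
  assumes u: "u \<in> H01 \<Omega>" and J: "Jfun \<Omega> f u < ereal \<eta>" and \<sigma>: "0 < \<sigma>" "\<sigma> < 1"
  shows "\<exists>\<delta>>0. \<exists>H. dcont (epi_dist (H01_dist \<Omega>))
      (mball (epi (H01 \<Omega>) (Jfun \<Omega> f)) (epi_dist (H01_dist \<Omega>)) (u, \<eta>) \<delta> \<times> {0..\<delta>}) H \<and>
    (\<forall>w \<mu> t. (w, \<mu>) \<in> mball (epi (H01 \<Omega>) (Jfun \<Omega> f)) (epi_dist (H01_dist \<Omega>)) (u, \<eta>) \<delta> \<and> t \<in> {0..\<delta>} \<longrightarrow>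
        H ((w, \<mu>), t) \<in> epi (H01 \<Omega>) (Jfun \<Omega> f) \<and>
        epi_dist (H01_dist \<Omega>) (H ((w, \<mu>), t)) (w, \<mu>) \<le> t \<and>
        snd (H ((w, \<mu>), t)) \<le> \<mu> - \<sigma> * t \<and>
        fst (H ((H01_neg w, \<mu>), t)) = H01_neg (fst (H ((w, \<mu>), t))))"
proof -
  obtain a where a: "energy u = ennreal a" "a \<ge> 0" "a < \<eta>"
  proof (cases "energy u")
    case (real r)
    then show ?thesis using J that[of r] by (simp add: Jfun_energy enn2ereal_ennreal)
  next
    case top
    then show ?thesis using J by (simp add: Jfun_energy)
  qed
  \<comment> \<open>A third of the gap: the cut energy will stay below \<open>a + \<gamma>\<close>
    and the height above \<open>\<eta> - \<gamma> = a + 2 * \<gamma>\<close>, which leaves a margin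
    larger than \<open>\<gamma>\<close> between them.\<close>
  define \<gamma> where "\<gamma> = (\<eta> - a) / 3"
  \<comment> \<open>Chosen so that
    \<open>\<tau> * \<epsilon> = t * sqrt (1 - \<sigma>\<^sup>2)\<close>: this horizontal
    displacement and the vertical one \<open>\<sigma> * t\<close> combine to exactly t.\<close>
  define \<epsilon> where "\<epsilon> = \<gamma> * sqrt (1 - \<sigma>\<^sup>2) / \<sigma>"
  have \<gamma>: "\<gamma> > 0" "\<eta> = a + 3 * \<gamma>" using a by (auto simp: \<gamma>_def field_simps)
  have \<sigma>2: "\<sigma>\<^sup>2 < 1" using \<sigma> by (simp add: power_less_one_iff)
  then have \<epsilon>: "\<epsilon> > 0" using \<gamma> \<sigma> by (simp add: \<epsilon>_def)
  have "\<forall>\<^sub>F k in sequentially. trunc_defect \<Omega> (real k) u < ennreal (\<epsilon>\<^sup>2)"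
    using \<epsilon> by (intro order_tendstoD(2)[OF trunc_defect_tendsto_0[OF u domain(1)]]) simp
  moreover have "\<forall>\<^sub>F k in sequentially. R \<le> real k" by (rule eventually_compose_filterlim[OF eventually_ge_at_top filterlim_real_sequentially])
  ultimately obtain K where K: "trunc_defect \<Omega> K u < ennreal (\<epsilon>\<^sup>2)" "R \<le> K"
    using eventually_happens'[OF sequentially_bot eventually_conj] by blast
  have K0: "K \<ge> 0" using K R_pos by linarith
  have cu: "cut_energy K u < ennreal (a + \<gamma>)"
    using cut_energy_le[OF K0, of u] a \<gamma> by (auto simp: ennreal_lessI intro: le_less_trans)
  \<comment> \<open>Only now is a radius chosen: \<open>K\<close> is fixed by its behaviour at
    \<open>u\<close>, and both strict bounds extend to a ball by continuity.\<close>
  obtain \<delta>0 where \<delta>0: "\<delta>0 > 0"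
    "\<And>v. v \<in> H01 \<Omega> \<Longrightarrow> H01_dist \<Omega> u v < \<delta>0 \<Longrightarrow> cut_energy K v < ennreal (a + \<gamma>) \<and> trunc_defect \<Omega> K v < ennreal (\<epsilon>\<^sup>2)"
  proof (rule H01_neighbourhood)
    fix X assume X: "\<And>n::nat. X n \<in> H01 \<Omega>" "(\<lambda>n. H01_dist \<Omega> (X n) u) \<longlonglongrightarrow> 0"
    show "\<forall>\<^sub>F n in sequentially. cut_energy K (X n) < ennreal (a + \<gamma>) \<and> trunc_defect \<Omega> K (X n) < ennreal (\<epsilon>\<^sup>2)"
      using order_tendstoD(2)[OF cut_energy_continuous[OF X(1) u K0 X(2)] cu]
        order_tendstoD(2)[OF trunc_defect_continuous[OF X(1) u domain K0 X(2)] K(1)]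
      by (rule eventually_conj)
  qed blast
  \<comment> \<open>The three bounds keep the point where the estimates hold, keep the height above
    \<open>\<eta> - \<gamma>\<close>, and keep \<open>\<tau>\<close> at most 1.\<close>
  define \<delta> where "\<delta> = min \<delta>0 (min \<gamma> (\<gamma> / \<sigma>))"
  have \<delta>: "\<delta> > 0" "\<delta> \<le> \<delta>0" "\<delta> \<le> \<gamma>" "\<delta> \<le> \<gamma> / \<sigma>" using \<delta>0 \<gamma> \<sigma> by (auto simp: \<delta>_def)
  define H where "H z = (deform K (\<sigma> * snd z / \<gamma>) (fst (fst z)), snd (fst z) - \<sigma> * snd z)"
    for z :: "((('a \<Rightarrow> real) \<times> ('a \<Rightarrow> 'a)) \<times> real) \<times> real"
  let ?d = "H01_dist \<Omega>"
  let ?B = "mball (epi (H01 \<Omega>) (Jfun \<Omega> f)) (epi_dist ?d) (u, \<eta>) \<delta>"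
  have \<tau>: "0 \<le> \<sigma> * t / \<gamma>" "\<sigma> * t / \<gamma> \<le> 1" if "t \<in> {0..\<delta>}" for t
  proof -
    have "t \<le> \<gamma> / \<sigma>" using that \<delta> by simp
    then show "0 \<le> \<sigma> * t / \<gamma>" "\<sigma> * t / \<gamma> \<le> 1" using that \<sigma> \<gamma> by (auto simp: field_simps)
  qed
  have B: "w \<in> H01 \<Omega>" "Jfun \<Omega> f w \<le> ereal \<mu>" "?d u w < \<delta>0" "\<mu> > \<eta> - \<gamma>" if "(w, \<mu>) \<in> ?B" for w \<mu>
  proof -
    have "?d u w < \<delta>" "\<bar>\<eta> - \<mu>\<bar> < \<delta>"
      using that epi_dist_bounds[where d="?d" and p="(u,\<eta>)" and q="(w,\<mu>)"] by (auto simp: mball_def)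
    then show "?d u w < \<delta>0" "\<mu> > \<eta> - \<gamma>" using \<delta> by auto
  qed (use that in \<open>auto simp: mball_def epi_def\<close>)
  have cont: "dcont (epi_dist ?d) (?B \<times> {0..\<delta>}) H"
  proof (rule dcont_sequentialI)
    fix z X assume z: "z \<in> ?B \<times> {0..\<delta>}" and X: "\<And>n. X n \<in> ?B \<times> {0..\<delta>}"
      and l1: "(\<lambda>n. epi_dist ?d (fst (X n)) (fst z)) \<longlonglongrightarrow> 0" and l2: "(\<lambda>n. snd (X n)) \<longlonglongrightarrow> snd z"
    have l3: "(\<lambda>n. ?d (fst (fst (X n))) (fst (fst z))) \<longlonglongrightarrow> 0"
      by (rule tendsto_sandwich[OF _ _ tendsto_const l1])
         (auto intro!: always_eventually epi_dist_bounds H01_dist_nonneg)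
    have "(\<lambda>n. \<bar>snd (fst (X n)) - snd (fst z)\<bar>) \<longlonglongrightarrow> 0"
      by (rule tendsto_sandwich[OF _ _ tendsto_const l1]) (auto intro!: always_eventually epi_dist_bounds)
    then have l4: "(\<lambda>n. snd (fst (X n))) \<longlonglongrightarrow> snd (fst z)"
      by (simp add: tendsto_rabs_zero_iff LIM_zero_iff)
    have XH: "fst (fst (X n)) \<in> H01 \<Omega>" "snd (X n) \<in> {0..\<delta>}" for n
      using X[of n] B by (auto simp: mem_Times_iff) (metis prod.collapse)
    have zH: "fst (fst z) \<in> H01 \<Omega>" "snd z \<in> {0..\<delta>}"
      using z B by (auto simp: mem_Times_iff) (metis prod.collapse)
    have "(\<lambda>n. ?d (fst (H (X n))) (fst (H z))) \<longlonglongrightarrow> 0"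
      unfolding H_def fst_conv
    proof (rule deform_continuous[OF XH(1) zH(1) domain K0 l3])
      show "(\<lambda>n. \<sigma> * snd (X n) / \<gamma>) \<longlonglongrightarrow> \<sigma> * snd z / \<gamma>" using \<gamma> by (intro tendsto_intros l2) auto
    qed (use \<tau> XH zH in auto)
    moreover have "(\<lambda>n. snd (H (X n)) - snd (H z)) \<longlonglongrightarrow> snd (H z) - snd (H z)"
      unfolding H_def snd_conv by (intro tendsto_intros l2 l4)
    ultimately have "(\<lambda>n. sqrt ((?d (fst (H (X n))) (fst (H z)))\<^sup>2 + (snd (H (X n)) - snd (H z))\<^sup>2))
        \<longlonglongrightarrow> sqrt (0\<^sup>2 + (snd (H z) - snd (H z))\<^sup>2)"
      by (intro tendsto_real_sqrt tendsto_add tendsto_power)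
    then show "(\<lambda>n. epi_dist ?d (H (X n)) (H z)) \<longlonglongrightarrow> 0" by (simp add: epi_dist_def)
  qed (rule epi_dist_bounds)
  have main: "H ((w, \<mu>), t) \<in> epi (H01 \<Omega>) (Jfun \<Omega> f) \<and> epi_dist ?d (H ((w, \<mu>), t)) (w, \<mu>) \<le> t"
    if w: "(w, \<mu>) \<in> ?B" and t: "t \<in> {0..\<delta>}" for w \<mu> t
  proof
    let ?\<tau> = "\<sigma> * t / \<gamma>"
    note B = B[OF w] and \<tau> = \<tau>[OF t]
    have cw: "cut_energy K w < ennreal (a + \<gamma>)" and tw: "trunc_defect \<Omega> K w < ennreal (\<epsilon>\<^sup>2)"
      using \<delta>0(2)[OF B(1,3)] by auto
    have \<mu>: "\<mu> > a + 2 * \<gamma>" "\<mu> \<ge> 0" using B(4) \<gamma> a by auto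
    have comb: "ennreal b * ennreal b' + ennreal c * ennreal c' = ennreal (b * b' + c * c')"
      if "0 \<le> b" "0 \<le> b'" "0 \<le> c" "0 \<le> c'" for b b' c c' :: real
      using that by (simp add: ennreal_mult ennreal_plus)
    have ew: "energy w \<le> ennreal \<mu>"
      using B(2) \<mu>(2) by (simp add: Jfun_energy less_eq_ennreal.rep_eq enn2ereal_ennreal)
    have "energy (deform K ?\<tau> w) \<le> ennreal (1 - ?\<tau>) * energy w + ennreal ?\<tau> * cut_energy K w"
      by (rule energy_deform_le[OF B(1) K(2) \<tau>])
    also have "\<dots> \<le> ennreal (1 - ?\<tau>) * ennreal \<mu> + ennreal ?\<tau> * ennreal (a + \<gamma>)"
      using ew cw by (intro add_mono mult_left_mono) auto
    also have "\<dots> = ennreal ((1 - ?\<tau>) * \<mu> + ?\<tau> * (a + \<gamma>))"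
      by (rule comb) (use \<tau> \<mu> a \<gamma> in auto)
    also have "\<dots> \<le> ennreal (\<mu> - \<sigma> * t)"
    proof (rule ennreal_leI)
      have "\<sigma> * t = ?\<tau> * \<gamma>" using \<gamma> by simp
      also have "\<dots> \<le> ?\<tau> * (\<mu> - (a + \<gamma>))" using \<tau> \<mu> by (intro mult_left_mono) auto
      finally have "\<mu> - ?\<tau> * (\<mu> - (a + \<gamma>)) \<le> \<mu> - \<sigma> * t" by (rule diff_left_mono)
      moreover have "(1 - r) * \<mu> + r * (a + \<gamma>) = \<mu> - r * (\<mu> - (a + \<gamma>))" for r
        by (simp add: algebra_simps)
      ultimately show "(1 - ?\<tau>) * \<mu> + ?\<tau> * (a + \<gamma>) \<le> \<mu> - \<sigma> * t" by (simp only:)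
    qed
    finally have le: "energy (deform K ?\<tau> w) \<le> ennreal (\<mu> - \<sigma> * t)" .
    \<comment> \<open>\<open>ennreal\<close> sends negative reals to 0, so the bound can be read
      back in \<open>ereal\<close> only after the new height is known to be nonnegative.\<close>
    have "\<sigma> * t \<le> 1 * \<gamma>" using \<tau>(2) \<gamma> by (simp add: field_simps)
    then have "\<mu> - \<sigma> * t \<ge> 0" using \<mu> a \<gamma> by linarith
    then have "Jfun \<Omega> f (deform K ?\<tau> w) \<le> ereal (\<mu> - \<sigma> * t)"
      using le by (simp add: Jfun_energy less_eq_ennreal.rep_eq enn2ereal_ennreal)
    then show "H ((w, \<mu>), t) \<in> epi (H01 \<Omega>) (Jfun \<Omega> f)"
      using deform_in_H01[OF B(1) domain(1) \<tau> K0] by (simp add: epi_def H_def)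
    have "enn2real (trunc_defect \<Omega> K w) \<le> \<epsilon>\<^sup>2"
      using tw by (intro enn2real_leI) auto
    then have "(?d (deform K ?\<tau> w) w)\<^sup>2 \<le> ?\<tau>\<^sup>2 * \<epsilon>\<^sup>2"
      unfolding deform_dist[OF B(1) domain(1) \<tau>(1)] power_mult_distrib[of ?\<tau>]
      by (intro mult_left_mono) auto
    also have "\<dots> = t\<^sup>2 * (1 - \<sigma>\<^sup>2)"
      using \<gamma> \<sigma> \<sigma>2 by (simp add: \<epsilon>_def power_mult_distrib power_divide field_simps)
    finally have "(?d (deform K ?\<tau> w) w)\<^sup>2 + (\<sigma> * t)\<^sup>2 \<le> t\<^sup>2" by (simp add: algebra_simps power_mult_distrib)
    then show "epi_dist ?d (H ((w, \<mu>), t)) (w, \<mu>) \<le> t"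
      using t by (auto simp: epi_dist_def H_def intro!: real_le_lsqrt)
  qed
  show ?thesis
    by (rule exI[of _ \<delta>], rule conjI[OF \<delta>(1)], rule exI[of _ H], rule conjI[OF cont])
       (use main in \<open>auto simp: H_def deform_neg\<close>)
qed

section \<open>Computation of the two slopes\<close>

lemma slope_le_1:
  assumes u: "u \<in> H01 \<Omega>" and J: "Jfun \<Omega> f u < ereal \<eta>" and \<delta>: "\<delta> > 0"
    and H: "\<And>t. t \<in> {0..\<delta>} \<Longrightarrow> (u, \<eta>) \<in> mball (epi (H01 \<Omega>) (Jfun \<Omega> f)) (epi_dist (H01_dist \<Omega>)) (u, \<eta>) \<delta> \<Longrightarrow>
       epi_dist (H01_dist \<Omega>) (H t) (u, \<eta>) \<le> t \<and> snd (H t) \<le> \<eta> - \<sigma> * t"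
  shows "\<sigma> \<le> 1"
proof -
  have "(u, \<eta>) \<in> mball (epi (H01 \<Omega>) (Jfun \<Omega> f)) (epi_dist (H01_dist \<Omega>)) (u, \<eta>) \<delta>"
    using u J \<delta> by (auto simp: mball_def epi_def epi_dist_def H01_dist_self)
  then have "epi_dist (H01_dist \<Omega>) (H \<delta>) (u, \<eta>) \<le> \<delta>" "snd (H \<delta>) \<le> \<eta> - \<sigma> * \<delta>"
    using H[of \<delta>] \<delta> by auto
  \<comment> \<open>The height is 1-Lipschitz for \<open>epi_dist\<close>; evaluation at the full
    time, which is positive, allows division.\<close>
  then have "\<sigma> * \<delta> \<le> 1 * \<delta>"
    using epi_dist_bounds(1)[where p="H \<delta>" and q="(u, \<eta>)" and d="H01_dist \<Omega>"] by simp
  then show ?thesis using \<delta> by (simp del: mult_1)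
qed

lemma epi_slope_eq_1:
  assumes u: "u \<in> H01 \<Omega>" and J: "Jfun \<Omega> f u < ereal \<eta>"
  shows "epi_slope (H01 \<Omega>) (H01_dist \<Omega>) (Jfun \<Omega> f) (u, \<eta>) = 1"
  unfolding epi_slope_def wslope_def
proof (rule SUP_unit_interval)
  let ?B = "\<lambda>\<delta>. mball (epi (H01 \<Omega>) (Jfun \<Omega> f)) (epi_dist (H01_dist \<Omega>)) (u, \<eta>) \<delta>"
  let ?S = "{\<sigma>::real. 0 \<le> \<sigma> \<and> (\<exists>\<delta>>0. \<exists>H. dcont (epi_dist (H01_dist \<Omega>)) (?B \<delta> \<times> {0..\<delta>}) H \<and>
      (\<forall>v\<in>?B \<delta>. \<forall>t\<in>{0..\<delta>}. H (v, t) \<in> epi (H01 \<Omega>) (Jfun \<Omega> f) \<and>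
         epi_dist (H01_dist \<Omega>) (H (v, t)) v \<le> t \<and> snd (H (v, t)) \<le> snd v - \<sigma> * t))}"
  show "{0<..<1} \<subseteq> ?S"
  proof
    fix \<sigma> :: real assume "\<sigma> \<in> {0<..<1}"
    then have \<sigma>: "0 < \<sigma>" "\<sigma> < 1" by auto
    from epigraph_deformation[OF u J \<sigma>] obtain \<delta> H where \<delta>: "\<delta> > 0"
      and H: "dcont (epi_dist (H01_dist \<Omega>)) (?B \<delta> \<times> {0..\<delta>}) H"
      "\<And>w \<mu> t. (w, \<mu>) \<in> ?B \<delta> \<and> t \<in> {0..\<delta>} \<Longrightarrow> H ((w, \<mu>), t) \<in> epi (H01 \<Omega>) (Jfun \<Omega> f) \<and>
        epi_dist (H01_dist \<Omega>) (H ((w, \<mu>), t)) (w, \<mu>) \<le> t \<and> snd (H ((w, \<mu>), t)) \<le> \<mu> - \<sigma> * t"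
      by blast
    show "\<sigma> \<in> ?S"
      by (rule CollectI, rule conjI[OF less_imp_le[OF \<sigma>(1)]], rule exI[of _ \<delta>], rule conjI[OF \<delta>],
          rule exI[of _ H], rule conjI[OF H(1)]) (use H(2) in \<open>auto simp del: atLeastAtMost_iff\<close>)
  qed
  fix \<sigma> assume "\<sigma> \<in> ?S"
  then obtain \<delta> H where H: "\<delta> > 0" "\<forall>v\<in>?B \<delta>. \<forall>t\<in>{0..\<delta>}. H (v, t) \<in> epi (H01 \<Omega>) (Jfun \<Omega> f) \<and>
         epi_dist (H01_dist \<Omega>) (H (v, t)) v \<le> t \<and> snd (H (v, t)) \<le> snd v - \<sigma> * t"
    by blast
  show "\<sigma> \<le> 1"
    by (rule slope_le_1[OF u J H(1), of "\<lambda>t. H ((u, \<eta>), t)"]) (use H(2) in fastforce)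
qed

lemma epi_slope_Z2_eq_1:
  assumes u: "u \<in> H01 \<Omega>" and J: "Jfun \<Omega> f u < ereal \<eta>"
  shows "epi_slope_Z2 (H01 \<Omega>) (H01_dist \<Omega>) (Jfun \<Omega> f) H01_neg u \<eta> = 1"
  unfolding epi_slope_Z2_def
proof (rule SUP_unit_interval)
  let ?B = "\<lambda>\<delta>. mball (epi (H01 \<Omega>) (Jfun \<Omega> f)) (epi_dist (H01_dist \<Omega>)) (u, \<eta>) \<delta>"
  let ?S = "{\<sigma>::real. 0 \<le> \<sigma> \<and> (\<exists>\<delta>>0. \<exists>H. dcont (epi_dist (H01_dist \<Omega>)) (?B \<delta> \<times> {0..\<delta>}) H \<and>
      (\<forall>w \<mu> t. (w, \<mu>) \<in> ?B \<delta> \<and> t \<in> {0..\<delta>} \<longrightarrow> H ((w, \<mu>), t) \<in> epi (H01 \<Omega>) (Jfun \<Omega> f) \<and>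
         epi_dist (H01_dist \<Omega>) (H ((w, \<mu>), t)) (w, \<mu>) \<le> t \<and> snd (H ((w, \<mu>), t)) \<le> \<mu> - \<sigma> * t \<and>
         fst (H ((H01_neg w, \<mu>), t)) = H01_neg (fst (H ((w, \<mu>), t)))))}"
  show "{0<..<1} \<subseteq> ?S"
  proof
    fix \<sigma> :: real assume "\<sigma> \<in> {0<..<1}"
    then have \<sigma>: "0 < \<sigma>" "\<sigma> < 1" by auto
    show "\<sigma> \<in> ?S"
      by (rule CollectI, rule conjI[OF less_imp_le[OF \<sigma>(1)] epigraph_deformation[OF u J \<sigma>]])
  qed
  fix \<sigma> assume "\<sigma> \<in> ?S"
  then obtain \<delta> H where H: "\<delta> > 0" "\<forall>w \<mu> t. (w, \<mu>) \<in> ?B \<delta> \<and> t \<in> {0..\<delta>} \<longrightarrow> H ((w, \<mu>), t) \<in> epi (H01 \<Omega>) (Jfun \<Omega> f) \<and>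
         epi_dist (H01_dist \<Omega>) (H ((w, \<mu>), t)) (w, \<mu>) \<le> t \<and> snd (H ((w, \<mu>), t)) \<le> \<mu> - \<sigma> * t"
    by blast
  show "\<sigma> \<le> 1"
    by (rule slope_le_1[OF u J H(1), of "\<lambda>t. H ((u, \<eta>), t)"]) (use H(2) in blast)
qed

end

section \<open>From almost-everywhere hypotheses to a regular integrand\<close>

lemma strictly_convex_star:
  assumes "strictly_convex h" "h 0 = 0" "0 \<le> c" "c \<le> 1"
  shows "h (c *\<^sub>R \<xi>) \<le> c * h \<xi>"
proof -
  \<comment> \<open>Strict convexity speaks of distinct points and weights strictly between 0 and 1
    only; in the remaining cases h 0 = 0 gives equality.\<close>
  consider "c = 0" | "c = 1" | "\<xi> = 0" | "0 < c" "c < 1" "\<xi> \<noteq> 0" using assms by linarith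
  then show ?thesis
  proof cases
    case 4
    then have "h ((1 - c) *\<^sub>R 0 + c *\<^sub>R \<xi>) < (1 - c) * h 0 + c * h \<xi>"
      using assms(1) unfolding strictly_convex_def by metis
    then show ?thesis using assms(2) by simp
  qed (use assms in auto)
qed

theorem theorem3p11:
  fixes \<Omega> :: "(real^'n) set"
    and j :: "real^'n \<Rightarrow> real \<Rightarrow> real^'n \<Rightarrow> real"
    and js :: "real^'n \<Rightarrow> real \<Rightarrow> real^'n \<Rightarrow> real"
    and jxi :: "real^'n \<Rightarrow> real \<Rightarrow> real^'n \<Rightarrow> real^'n"
    and \<alpha>0 :: real and \<alpha> :: "real \<Rightarrow> real"
  assumes dim: "CARD('n) \<ge> 3"
    and \<Omega>: "open \<Omega>" "bounded \<Omega>"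
    and meas: "\<And>s \<xi>. (\<lambda>x. j x s \<xi>) \<in> borel_measurable (lebesgue_on \<Omega>)"
    and C1: "AE x in lebesgue. x \<in> \<Omega> \<longrightarrow>
              (\<forall>s \<xi>. ((\<lambda>p. j x (fst p) (snd p)) has_derivative
                         (\<lambda>h. js x s \<xi> * fst h + jxi x s \<xi> \<bullet> snd h)) (at (s, \<xi>))) \<and>
              continuous_on UNIV (\<lambda>p. js x (fst p) (snd p)) \<and>
              continuous_on UNIV (\<lambda>p. jxi x (fst p) (snd p))"
    and H1: "AE x in lebesgue. x \<in> \<Omega> \<longrightarrow> (\<forall>s. strictly_convex (\<lambda>\<xi>. j x s \<xi>))"
    and H2: "\<alpha>0 > 0" "\<forall>t\<ge>0. \<alpha> t > 0" "mono_on {0..} \<alpha>" "continuous_on {0..} \<alpha>"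
            "AE x in lebesgue. x \<in> \<Omega> \<longrightarrow>
               (\<forall>s \<xi>. \<alpha>0 * (norm \<xi>)\<^sup>2 \<le> j x s \<xi> \<and> j x s \<xi> \<le> \<alpha> \<bar>s\<bar> * (norm \<xi>)\<^sup>2)"
    and H4: "\<exists>R>0. AE x in lebesgue. x \<in> \<Omega> \<longrightarrow> (\<forall>s \<xi>. \<bar>s\<bar> \<ge> R \<longrightarrow> js x s \<xi> * s \<ge> 0)"
  shows "(\<forall>u \<eta>. u \<in> H01 \<Omega> \<and> Jfun \<Omega> j u < ereal \<eta> \<longrightarrow>
            epi_slope (H01 \<Omega>) (H01_dist \<Omega>) (Jfun \<Omega> j) (u, \<eta>) = 1) \<and>
         ((AE x in lebesgue. x \<in> \<Omega> \<longrightarrow> (\<forall>s \<xi>. j x (- s) (- \<xi>) = j x s \<xi>)) \<longrightarrow>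
            Jfun \<Omega> j H01_zero = 0 \<and>
            (\<forall>\<eta>>0. epi_slope_Z2 (H01 \<Omega>) (H01_dist \<Omega>) (Jfun \<Omega> j) H01_neg H01_zero \<eta> = 1))"
proof -
  obtain R where R: "R > 0" and H4': "AE x in lebesgue. x \<in> \<Omega> \<longrightarrow> (\<forall>s \<xi>. \<bar>s\<bar> \<ge> R \<longrightarrow> js x s \<xi> * s \<ge> 0)"
    using H4 by blast
  have \<Omega>s: "\<Omega> \<in> sets lebesgue" using \<Omega>(1) by auto
  define good where "good x \<longleftrightarrow>
      (\<forall>s \<xi>. ((\<lambda>p. j x (fst p) (snd p)) has_derivative
                         (\<lambda>h. js x s \<xi> * fst h + jxi x s \<xi> \<bullet> snd h)) (at (s, \<xi>))) \<and>
      (\<forall>s. strictly_convex (\<lambda>\<xi>. j x s \<xi>)) \<and>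
      (\<forall>s \<xi>. \<alpha>0 * (norm \<xi>)\<^sup>2 \<le> j x s \<xi> \<and> j x s \<xi> \<le> \<alpha> \<bar>s\<bar> * (norm \<xi>)\<^sup>2) \<and>
      (\<forall>s \<xi>. \<bar>s\<bar> \<ge> R \<longrightarrow> js x s \<xi> * s \<ge> 0)" for x
  have "AE x in lebesgue. x \<in> \<Omega> \<longrightarrow> good x"
    using C1 H1 H2(5) H4' by eventually_elim (simp add: good_def)
  then obtain N where N0: "\<And>x. x \<in> space lebesgue - N \<Longrightarrow> x \<in> \<Omega> \<longrightarrow> good x"
    and N1: "N \<in> null_sets lebesgue"
    by (rule AE_E3) blast
  have N: "N \<in> null_sets lebesgue" "\<And>x. x \<in> \<Omega> \<Longrightarrow> x \<notin> N \<Longrightarrow> good x"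
    using N0 N1 by auto
  \<comment> \<open>Setting the integrand to 0 on the null set and outside \<Omega> leaves the
    integral unchanged and makes the pointwise conditions hold everywhere.\<close>
  define f where "f x = (if x \<in> \<Omega> - N then j x else (\<lambda>s \<xi>. 0))" for x
  have J: "Jfun \<Omega> j p = Jfun \<Omega> f p" for p
  proof -
    have "AE x in lebesgue. x \<notin> N" using N(1) by (rule AE_not_in)
    then have "(\<integral>\<^sup>+x\<in>\<Omega>. ennreal (j x (fst p x) (snd p x)) \<partial>lebesgue) = (\<integral>\<^sup>+x\<in>\<Omega>. ennreal (f x (fst p x) (snd p x)) \<partial>lebesgue)"
      by (intro nn_integral_cong_AE, eventually_elim) (auto simp: f_def indicator_def)
    then show ?thesis by (simp add: Jfun_def)
  qed
  \<comment> \<open>Both quadratic bounds vanish at zero gradient and squeeze the value to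
    0.\<close>
  have zero: "j x s 0 = 0" if "good x" for x s
    using that unfolding good_def by (metis antisym mult_zero_right norm_zero zero_power2)
  have nonneg: "0 \<le> j x s \<xi>" if "good x" for x s \<xi>
    using that H2(1) unfolding good_def by (meson mult_nonneg_nonneg less_imp_le order_trans zero_le_power2)
  have deriv: "((\<lambda>s. j x s \<xi>) has_real_derivative js x s \<xi>) (at s)" if "good x" for x s \<xi>
  proof -
    have 1: "((\<lambda>s. (s, \<xi>)) has_derivative (\<lambda>h. (h, 0))) (at s)" by (auto intro!: derivative_eq_intros)
    have "((\<lambda>p. j x (fst p) (snd p)) has_derivative (\<lambda>h. js x s \<xi> * fst h + jxi x s \<xi> \<bullet> snd h)) (at (s, \<xi>))"
      using that by (simp add: good_def)
    from has_derivative_compose[OF 1 this] show ?thesis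
      by (simp add: has_field_derivative_def)
  qed
  have sign: "js x s \<xi> * s \<ge> 0" if "good x" "\<bar>s\<bar> \<ge> R" for x s \<xi>
    using that by (simp add: good_def)
  interpret regular_integrand \<Omega> f \<alpha> R
  proof
    fix x :: "real^'n" and s t c :: real and \<xi> :: "real^'n"
    \<comment> \<open>Each condition below is split by whether \<open>f x\<close> is the zero
      integrand; if it is not, x is a good point.\<close>
    have gf: "f x = j x" "good x" if "f x \<noteq> (\<lambda>s \<xi>. 0)"
      using that N(2) by (auto simp: f_def split: if_splits)
    show "(\<lambda>x. f x s \<xi>) \<in> borel_measurable (lebesgue_on \<Omega>)"
    proof -
      have "(\<lambda>x. indicator (\<Omega> - N) x * j x s \<xi>) \<in> borel_measurable (lebesgue_on \<Omega>)"
        using N(1) \<Omega>s by (intro borel_measurable_times meas borel_measurable_indicator)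
           (auto simp: sets_restrict_space_iff)
      also have "(\<lambda>x. indicator (\<Omega> - N) x * j x s \<xi>) = (\<lambda>x. f x s \<xi>)"
        by (auto simp: f_def indicator_def fun_eq_iff)
      finally show ?thesis .
    qed
    show "continuous_on UNIV (\<lambda>p. f x (fst p) (snd p))"
    proof (cases "f x = (\<lambda>s \<xi>. 0)")
      case False
      have "((\<lambda>p. j x (fst p) (snd p)) has_derivative (\<lambda>h. js x (fst z) (snd z) * fst h + jxi x (fst z) (snd z) \<bullet> snd h)) (at z)" for z
        using gf(2)[OF False] by (cases z) (simp add: good_def)
      then show ?thesis unfolding gf(1)[OF False] by (blast intro: continuous_at_imp_continuous_on has_derivative_continuous)
    qed simp
    show "f x s (c *\<^sub>R \<xi>) \<le> c * f x s \<xi>" if "0 \<le> c" "c \<le> 1"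
      using gf zero[of x s] strictly_convex_star[of "j x s" c \<xi>] that
      by (cases "f x = (\<lambda>s \<xi>. 0)") (auto simp: good_def)
    show "0 \<le> f x s \<xi>" using gf nonneg by (cases "f x = (\<lambda>s \<xi>. 0)") auto
    show "f x s \<xi> \<le> \<alpha> \<bar>s\<bar> * (norm \<xi>)\<^sup>2"
      using gf H2(2) by (cases "f x = (\<lambda>s \<xi>. 0)") (auto simp: good_def less_imp_le)
    show "f x s \<xi> \<le> f x t \<xi>" if "R \<le> s" "s \<le> t"
    proof (cases "f x = (\<lambda>s \<xi>. 0)")
      case False
      have "j x s \<xi> \<le> j x t \<xi>"
      proof (rule DERIV_nonneg_imp_nondecreasing[OF that(2)])
        fix r assume r: "s \<le> r" "r \<le> t"
        \<comment> \<open>Here r >= R > 0, so the sign of the product is that of the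
          derivative.\<close>
        then have "js x r \<xi> \<ge> 0"
          using sign[OF gf(2)[OF False], of r \<xi>] that R by (simp add: zero_le_mult_iff)
        then show "\<exists>y. ((\<lambda>s. j x s \<xi>) has_real_derivative y) (at r) \<and> 0 \<le> y"
          using deriv[OF gf(2)[OF False]] by blast
      qed
      then show ?thesis by (simp add: gf[OF False])
    qed simp
    show "f x (- s) \<xi> \<le> f x (- t) \<xi>" if "R \<le> s" "s \<le> t"
    proof (cases "f x = (\<lambda>s \<xi>. 0)")
      case False
      have "j x (- s) \<xi> \<le> j x (- t) \<xi>"
      proof (rule DERIV_nonpos_imp_nonincreasing[of "- t" "- s" "\<lambda>s. j x s \<xi>"])
        show "- t \<le> - s" using that by simp
        fix r assume r: "- t \<le> r" "r \<le> - s"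
        then have "js x r \<xi> \<le> 0"
          using sign[OF gf(2)[OF False], of r \<xi>] that R by (simp add: zero_le_mult_iff)
        then show "\<exists>y. ((\<lambda>s. j x s \<xi>) has_real_derivative y) (at r) \<and> y \<le> 0"
          using deriv[OF gf(2)[OF False]] by blast
      qed
      then show ?thesis by (simp add: gf[OF False])
    qed simp
  qed (use \<Omega>s \<Omega> H2 R in auto)
  have J0: "Jfun \<Omega> j H01_zero = 0"
  proof -
    have "f x 0 0 = 0" for x using zero N(2) by (auto simp: f_def)
    then show ?thesis unfolding J by (simp add: Jfun_def H01_zero_def zero_ennreal.rep_eq)
  qed
  have Jf: "Jfun \<Omega> j = Jfun \<Omega> f" using J by blast
  show ?thesis
    using epi_slope_eq_1 epi_slope_Z2_eq_1[OF H01_zero_in[OF \<Omega>s]] J0 unfolding Jf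
    by (auto simp: zero_ereal_def)
qed

end
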